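(* Let $n,k$ be positive integers such that $(3k-2)\mid n$ and $3k-2\equiv 1$ or $4 \pmod{12}$. Then for every linear 4-tree $T_k$ with $k$ quadruples, $ex^{lin}_4(n,T_k)\ge \frac{n(k-1)}{4}$. This is sharp when $T_k$ is the linear 4-star $S_k$, i.e. under the same conditions on $n$ and $k$, $ex^{lin}_4(n,S_k)=\frac{n(k-1)}{4}$.
   Context: A quadruple system (4-uniform hypergraph) consists of a finite vertex set and a set of 4-element subsets of it, called edges or quadruples. It is linear if every pair of vertices is contained in at most one edge. It is $F$-free if it contains no subhypergraph isomorphic to $F$ (not necessarily induced). $ex^{lin}_4(n,F)$ is the maximum number of edges in an $F$-free linear quadruple system on $n$ vertices. A linear 4-tree is a 4-uniform hypergraph that can be constructed starting from a single quadruple and then, at each step, adding a new quadruple that intersects the union of the vertices of the previous quadruples in exactly one vertex. The linear 4-star $S_k$ is the linear 4-tree with $k$ quadruples all of which contain one common vertex (and are otherwise pairwise disjoint). It is a known theorem of Hanani that a Steiner system $S(2,4,m)$ (a set $V$ of $m$ points with a family of 4-element subsets such that each pair of points lies in exactly one of them) exists if and only if $m\equiv 1,4\pmod{12}$. *)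

theory Defs
  imports Complex_Main "HOL-Number_Theory.Cong"
begin

type_synonym 'a hypergraph = "'a set \<times> 'a set set"

abbreviation verts :: "'a hypergraph \<Rightarrow> 'a set" where "verts \<equiv> fst"

abbreviation edges :: "'a hypergraph \<Rightarrow> 'a set set" where "edges \<equiv> snd"

definition quadruple_system :: "'a hypergraph \<Rightarrow> bool" where
  "quadruple_system H \<longleftrightarrow> finite (verts H) \<and> (\<forall>e\<in>edges H. e \<subseteq> verts H \<and> card e = 4)"

definition linear_system :: "'a hypergraph \<Rightarrow> bool" where
  "linear_system H \<longleftrightarrow>
     (\<forall>x\<in>verts H. \<forall>y\<in>verts H. x \<noteq> y \<longrightarrow>
        (\<forall>e\<in>edges H. \<forall>f\<in>edges H. {x, y} \<subseteq> e \<longrightarrow> {x, y} \<subseteq> f \<longrightarrow> e = f))"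

definition subhypergraph :: "'a hypergraph \<Rightarrow> 'a hypergraph \<Rightarrow> bool" where
  "subhypergraph H' H \<longleftrightarrow>
     verts H' \<subseteq> verts H \<and> edges H' \<subseteq> edges H \<and> (\<forall>e\<in>edges H'. e \<subseteq> verts H')"

definition isomorphic :: "'a hypergraph \<Rightarrow> 'b hypergraph \<Rightarrow> bool" where
  "isomorphic H K \<longleftrightarrow> (\<exists>f. bij_betw f (verts H) (verts K) \<and> edges K = (\<lambda>e. f ` e) ` edges H)"

definition free_of :: "'b hypergraph \<Rightarrow> 'a hypergraph \<Rightarrow> bool" where
  "free_of F H \<longleftrightarrow> \<not> (\<exists>H'. subhypergraph H' H \<and> isomorphic F H')"

text \<open>Host systems have vertices in \<^typ>\<open>nat\<close>; this loses no generality, because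
  every finite hypergraph has an isomorphic copy there. The forbidden system may live on
  any type.\<close>

definition ex_lin4_sizes :: "nat \<Rightarrow> 'b hypergraph \<Rightarrow> nat set" where
  "ex_lin4_sizes n F =
     {card (edges H) |H :: nat hypergraph.
        quadruple_system H \<and> linear_system H \<and> card (verts H) = n \<and> free_of F H}"

definition ex_lin4 :: "nat \<Rightarrow> 'b hypergraph \<Rightarrow> nat" where
  "ex_lin4 n F = Max (ex_lin4_sizes n F)"

text \<open>The first argument is the number of quadruples. The vertex set is always the union of
  the quadruples.\<close>

inductive linear_4_tree :: "nat \<Rightarrow> 'a hypergraph \<Rightarrow> bool" where
  single: "card e = 4 \<Longrightarrow> linear_4_tree 1 (e, {e})"
| add: "linear_4_tree k (V, E) \<Longrightarrow> card e = 4 \<Longrightarrow> card (e \<inter> V) = 1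
          \<Longrightarrow> linear_4_tree (Suc k) (V \<union> e, insert e E)"

definition linear_4_star :: "nat \<Rightarrow> 'a hypergraph \<Rightarrow> bool" where
  "linear_4_star k S \<longleftrightarrow> linear_4_tree k S \<and>
     (\<exists>c. (\<forall>e\<in>edges S. c \<in> e) \<and>
          (\<forall>e\<in>edges S. \<forall>f\<in>edges S. e \<noteq> f \<longrightarrow> (e - {c}) \<inter> (f - {c}) = {}))"

lemma linear_4_tree_wf:
  assumes "linear_4_tree k T"
  shows "quadruple_system T" "verts T = \<Union> (edges T)" "card (edges T) = k" "edges T \<noteq> {}"
proof -
  have "quadruple_system T \<and> verts T = \<Union> (edges T) \<and> finite (edges T) \<and> card (edges T) = k
          \<and> edges T \<noteq> {}"
    using assms
  proof (induction rule: linear_4_tree.induct)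
    case (single e)
    then show ?case by (auto simp: quadruple_system_def intro: card_ge_0_finite)
  next
    case (add k V E e)
    have "e \<notin> E"
    proof
      assume "e \<in> E"
      then have "e \<inter> V = e" using add by (auto simp: quadruple_system_def)
      then show False using add by simp
    qed
    moreover have "finite e" using add by (auto intro: card_ge_0_finite)
    ultimately show ?case using add by (auto simp: quadruple_system_def)
  qed
  then show "quadruple_system T" "verts T = \<Union> (edges T)" "card (edges T) = k" "edges T \<noteq> {}"
    by auto
qed

lemma finite_ex_lin4_sizes: "finite (ex_lin4_sizes n F)"
proof (rule finite_subset)
  show "ex_lin4_sizes n F \<subseteq> {..2 ^ n}"
  proof
    fix m assume "m \<in> ex_lin4_sizes n F"
    then obtain H :: "nat hypergraph" where H: "m = card (edges H)" "quadruple_system H"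
        "card (verts H) = n"
      by (auto simp: ex_lin4_sizes_def)
    have "edges H \<subseteq> Pow (verts H)" "finite (verts H)"
      using H by (auto simp: quadruple_system_def)
    then have "card (edges H) \<le> card (Pow (verts H))" by (intro card_mono) auto
    then show "m \<in> {..2 ^ n}" using H \<open>finite (verts H)\<close> by (simp add: card_Pow)
  qed
qed simp

lemma ex_lin4_sizes_nonempty:
  assumes "edges F \<noteq> {}"
  shows "ex_lin4_sizes n F \<noteq> {}"
proof -
  let ?H = "({..<n}, {}) :: nat hypergraph"
  have "free_of F ?H"
    using assms by (auto simp: free_of_def subhypergraph_def isomorphic_def)
  then have "card (edges ?H) \<in> ex_lin4_sizes n F"
    unfolding ex_lin4_sizes_def
    by (intro CollectI exI[of _ ?H]) (auto simp: quadruple_system_def linear_system_def)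
  then show ?thesis by blast
qed

lemma linear_4_star_exists:
  assumes "k \<ge> 1"
  shows "\<exists>S :: nat hypergraph. linear_4_star k S"
proof -
  define q where "q i = {0, 3 * i + 1, 3 * i + 2, 3 * i + 3}" for i :: nat
  have q4: "card (q i) = 4" for i by (simp add: q_def)
  have disj: "q i \<inter> q j = {0}" if "i \<noteq> j" for i j
    using that unfolding q_def by (simp add: Int_insert_left)
  have "linear_4_tree (Suc m) (\<Union> (q ` {..m}), q ` {..m})" for m
  proof (induction m)
    case 0
    then show ?case using linear_4_tree.single[OF q4[of 0]] by simp
  next
    case (Suc m)
    have "q (Suc m) \<inter> \<Union> (q ` {..m}) = (\<Union>i\<in>{..m}. q (Suc m) \<inter> q i)" by auto
    also have "\<dots> = {0}" using disj by auto
    finally have "card (q (Suc m) \<inter> \<Union> (q ` {..m})) = 1" by simp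
    from linear_4_tree.add[OF Suc q4 this] show ?case
      by (simp add: atMost_Suc Un_commute)
  qed
  from this[of "k - 1"] assms
  have "linear_4_tree k (\<Union> (q ` {..k - 1}), q ` {..k - 1})" by simp
  moreover have "(q i - {0}) \<inter> (q j - {0}) = {}" if "q i \<noteq> q j" for i j
    using disj[of i j] that by blast
  moreover have "0 \<in> q i" for i by (simp add: q_def)
  ultimately show ?thesis
    unfolding linear_4_star_def by (intro exI[of _ "(\<Union> (q ` {..k - 1}), q ` {..k - 1})"]) (auto intro!: exI[of _ 0])
qed

end

theory Submission
  imports Defs
begin

text \<open>
  The bound for stars is double counting. In a linear system any \<open>k\<close> quadruples through one
  vertex meet nowhere else, so they form the star with \<open>k\<close> quadruples
  (\<open>degree_less_if_star_free\<close>). Hence all degrees of a star-free system are at most \<open>k - 1\<close>, and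
  their sum is four times the number of quadruples.

  For the lower bound, take disjoint copies of a Steiner system \<open>S(2,4,3k-2)\<close>. Every vertex then has
  degree \<open>k - 1\<close>, and a linear 4-tree with \<open>k\<close> quadruples cannot occur: it is connected, so it would
  lie inside one copy, but it has \<open>3k + 1\<close> vertices (\<open>free_of_linear_4_tree_if_small_components\<close>).

  All depth lies in the existence of \<open>S(2,4,v)\<close> for \<open>v \<equiv> 1, 4 (mod 12)\<close>, that is, for \<open>v = 3r + 1\<close>
  with \<open>r \<equiv> 0, 1 (mod 4)\<close>. Deleting a point from such a system leaves \<open>r\<close> groups of three points and
  quadruples that cover each pair of points from different groups once, and the step can be
  reversed. So the question is for which \<open>r\<close> such a group divisible design exists; the set of
  these \<open>r\<close> is \<open>gdd3_orders\<close>. It is closed under pairwise balanced designs: if \<open>r\<close> points carry a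
  family of blocks that covers each pair of points once, and all block sizes are in the set, then so
  is \<open>r\<close>, since after tripling the points each block can be filled with its own design
  (\<open>card_in_gdd3_orders\<close>). Two kinds of pairwise balanced designs suffice.

  \<^item> The Steiner system on \<open>3r + 1\<close> points itself, with blocks of size 4, leads from \<open>r\<close> to \<open>3r + 1\<close>.
  \<^item> For \<open>t\<close> coprime to 6, the lines over the integers modulo \<open>t\<close> form a transversal design with five
    groups of size \<open>t\<close>. Shortening one group to \<open>h\<close> points, and optionally adding one point to all
    groups, gives \<open>4t + h + e\<close> points and blocks of the sizes \<open>4, 5, t + e, h + e\<close>, where \<open>e\<close> is 0 or 1
    (\<open>truncated_transversal_in_gdd3_orders\<close>).

  Among any four consecutive integers one is coprime to 6, so for \<open>r \<ge> 77\<close> a suitable \<open>t\<close> always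
  exists, and induction reduces the problem to small \<open>r\<close>. The orders that the two rules do not
  reach are \<open>0, 1, 4, 5, 8, 9, 12, 17, 41, 44\<close>; the last eight come from explicit designs, most of
  them with a cyclic group of automorphisms.
\<close>

section \<open>Designs with three points over each order\<close>

text \<open>
  The groups are the triples \<open>{x} \<times> {0..2}\<close>. Building them into the point set lets designs on
  different subsets of \<open>X\<close> be put together without any matching of groups.
\<close>

definition gdd3 :: "'a set \<Rightarrow> ('a \<times> int) set set \<Rightarrow> bool" where
  "gdd3 X \<B> \<longleftrightarrow>
     (\<forall>B\<in>\<B>. B \<subseteq> X \<times> {0..2} \<and> card B = 4 \<and> inj_on fst B) \<and>
     (\<forall>p\<in>X \<times> {0..2}. \<forall>q\<in>X \<times> {0..2}. fst p \<noteq> fst q \<longrightarrow> (\<exists>B\<in>\<B>. p \<in> B \<and> q \<in> B)) \<and>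
     (\<forall>B\<in>\<B>. \<forall>C\<in>\<B>. \<forall>p q. p \<in> B \<inter> C \<longrightarrow> q \<in> B \<inter> C \<longrightarrow> p \<noteq> q \<longrightarrow> B = C)"

definition gdd3_orders :: "nat set" where
  "gdd3_orders = {r. \<exists>\<B>. gdd3 {..<r} \<B>}"

text \<open>
  A pairwise balanced design. Blocks with fewer than two points are permitted; they arise when a
  group of a transversal design is shortened to at most one point.
\<close>

definition pbd :: "'a set \<Rightarrow> 'a set set \<Rightarrow> bool" where
  "pbd X \<A> \<longleftrightarrow>
     (\<forall>A\<in>\<A>. A \<subseteq> X) \<and>
     (\<forall>x\<in>X. \<forall>y\<in>X. x \<noteq> y \<longrightarrow> (\<exists>A\<in>\<A>. x \<in> A \<and> y \<in> A)) \<and>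
     (\<forall>A\<in>\<A>. \<forall>A'\<in>\<A>. \<forall>x y. x \<in> A \<inter> A' \<longrightarrow> y \<in> A \<inter> A' \<longrightarrow> x \<noteq> y \<longrightarrow> A = A')"

lemma gdd3_block:
  assumes "gdd3 X \<B>" "B \<in> \<B>"
  shows "B \<subseteq> X \<times> {0..2}" "card B = 4" "inj_on fst B"
  using assms(1)[unfolded gdd3_def, THEN conjunct1] assms(2) by auto

lemma gdd3_cover:
  assumes "gdd3 X \<B>" "p \<in> X \<times> {0..2}" "q \<in> X \<times> {0..2}" "fst p \<noteq> fst q"
  obtains B where "B \<in> \<B>" "p \<in> B" "q \<in> B"
  using assms(2-) assms(1)[unfolded gdd3_def, THEN conjunct2, THEN conjunct1] by blast

lemma gdd3_unique:
  assumes "gdd3 X \<B>" "B \<in> \<B>" "C \<in> \<B>" "p \<in> B" "q \<in> B" "p \<in> C" "q \<in> C" "p \<noteq> q"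
  shows "B = C"
  using assms(2-) assms(1)[unfolded gdd3_def, THEN conjunct2, THEN conjunct2] by (metis IntI)

lemma pbd_subset:
  assumes "pbd X \<A>" "A \<in> \<A>"
  shows "A \<subseteq> X"
  using assms(1)[unfolded pbd_def, THEN conjunct1] assms(2) by auto

lemma pbd_cover:
  assumes "pbd X \<A>" "x \<in> X" "y \<in> X" "x \<noteq> y"
  obtains A where "A \<in> \<A>" "x \<in> A" "y \<in> A"
  using assms(2-) assms(1)[unfolded pbd_def, THEN conjunct2, THEN conjunct1] by blast

lemma pbd_unique:
  assumes "pbd X \<A>" "A \<in> \<A>" "A' \<in> \<A>" "x \<in> A" "y \<in> A" "x \<in> A'" "y \<in> A'" "x \<noteq> y"
  shows "A = A'"
  using assms(2-) assms(1)[unfolded pbd_def, THEN conjunct2, THEN conjunct2] by (metis IntI)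

lemma gdd3_image:
  assumes gdd: "gdd3 X \<B>" and f: "bij_betw f X Y"
  shows "gdd3 Y ((`) (map_prod f id) ` \<B>)"
proof -
  let ?g = "map_prod f id :: _ \<times> int \<Rightarrow> _"
  have f_inj: "inj_on f X" using f by (rule bij_betw_imp_inj_on)
  then have inj: "inj_on ?g (X \<times> {0..2})" by (intro map_prod_inj_on inj_on_id)
  have surj: "?g ` (X \<times> {0..2}) = Y \<times> {0..2}"
    by (intro map_prod_surj_on bij_betw_imp_surj_on[OF f]) simp
  note blocks = gdd3_block[OF gdd]
  show ?thesis
    unfolding gdd3_def
  proof (intro conjI ballI allI impI)
    fix C assume "C \<in> (`) ?g ` \<B>"
    then obtain B where B: "B \<in> \<B>" "C = ?g ` B" by auto
    show "C \<subseteq> Y \<times> {0..2}"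
      using image_mono[OF blocks(1)[OF B(1)], of ?g] unfolding B(2) surj .
    have "inj_on ?g B" using inj blocks(1)[OF B(1)] by (rule inj_on_subset)
    then show "card C = 4" using B blocks by (simp add: card_image)
    have "fst ` B \<subseteq> X" using blocks(1)[OF B(1)] by auto
    then have "inj_on (f \<circ> fst) B"
      by (intro comp_inj_on blocks(3)[OF B(1)] inj_on_subset[OF f_inj])
    then have "inj_on (fst \<circ> ?g) B" by (simp add: comp_def)
    then show "inj_on fst C" unfolding B(2) by (rule inj_on_imageI)
  next
    fix p' q' assume p': "p' \<in> Y \<times> {0..2::int}" and q': "q' \<in> Y \<times> {0..2::int}"
      and ne: "fst p' \<noteq> fst q'"
    obtain p where p: "p \<in> X \<times> {0..2}" "p' = ?g p"
      using p' unfolding surj[symmetric] by (rule imageE)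
    obtain q where q: "q \<in> X \<times> {0..2}" "q' = ?g q"
      using q' unfolding surj[symmetric] by (rule imageE)
    have "fst p \<noteq> fst q" using ne p(2) q(2) by (cases p; cases q) auto
    then obtain B where "B \<in> \<B>" "p \<in> B" "q \<in> B"
      using gdd3_cover[OF gdd p(1) q(1)] by blast
    then show "\<exists>C\<in>(`) ?g ` \<B>. p' \<in> C \<and> q' \<in> C" using p q by auto
  next
    fix C D p' q'
    assume "C \<in> (`) ?g ` \<B>" "D \<in> (`) ?g ` \<B>"
      and p': "p' \<in> C \<inter> D" and q': "q' \<in> C \<inter> D" and ne: "p' \<noteq> q'"
    then obtain A B where A: "A \<in> \<B>" "C = ?g ` A" and B: "B \<in> \<B>" "D = ?g ` B" by blast
    have CD: "C \<inter> D = ?g ` (A \<inter> B)"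
      using inj_on_image_Int[OF inj blocks(1)[OF A(1)] blocks(1)[OF B(1)]] A(2) B(2) by simp
    obtain p where p: "p \<in> A \<inter> B" "p' = ?g p" using p' unfolding CD by (rule imageE)
    obtain q where q: "q \<in> A \<inter> B" "q' = ?g q" using q' unfolding CD by (rule imageE)
    have "p \<noteq> q" using ne p(2) q(2) by blast
    then have "A = B" using gdd3_unique[OF gdd A(1) B(1)] p(1) q(1) by blast
    then show "C = D" using A B by simp
  qed
qed

lemma gdd3_orders_iff:
  assumes "finite X"
  shows "card X \<in> gdd3_orders \<longleftrightarrow> (\<exists>\<B>. gdd3 X \<B>)"
proof -
  obtain f where f: "bij_betw f X {..<card X}"
    using ex_bij_betw_finite_nat[OF assms] by (auto simp: atLeast0LessThan)
  show ?thesis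
    unfolding gdd3_orders_def
    using gdd3_image[OF _ f] gdd3_image[OF _ bij_betw_inv_into[OF f]] by blast
qed

text \<open>
  Wilson's fundamental construction with weight three: over each block \<open>A\<close> place a design on
  \<open>A \<times> {0..2}\<close>. Two points in different groups project to distinct points of \<open>X\<close>, which lie in a unique
  block, so they are covered exactly once.
\<close>

lemma card_in_gdd3_orders:
  assumes "finite X" "pbd X \<A>" "\<And>A. A \<in> \<A> \<Longrightarrow> card A \<in> gdd3_orders"
  shows "card X \<in> gdd3_orders"
proof -
  note sub = pbd_subset[OF assms(2)]
  have "\<exists>\<B>. gdd3 A \<B>" if "A \<in> \<A>" for A
    using gdd3_orders_iff[of A] assms(3)[OF that] finite_subset[OF sub[OF that] assms(1)] by simp
  then obtain \<G> where \<G>: "gdd3 A (\<G> A)" if "A \<in> \<A>" for A by metis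
  have block: "B \<subseteq> A \<times> {0..2}" "card B = 4" "inj_on fst B" if "A \<in> \<A>" "B \<in> \<G> A" for A B
    using gdd3_block[OF \<G>[OF that(1)] that(2)] by auto
  have "gdd3 X (\<Union>A\<in>\<A>. \<G> A)"
    unfolding gdd3_def
  proof (intro conjI ballI allI impI)
    fix B assume "B \<in> (\<Union>A\<in>\<A>. \<G> A)"
    then obtain A where "A \<in> \<A>" "B \<in> \<G> A" by auto
    then show "B \<subseteq> X \<times> {0..2}" "card B = 4" "inj_on fst B"
      using block[of A B] sub[of A] by auto
  next
    fix p q assume p: "p \<in> X \<times> {0..2::int}" and q: "q \<in> X \<times> {0..2::int}" and ne: "fst p \<noteq> fst q"
    have "fst p \<in> X" "fst q \<in> X" using p q by auto
    then obtain A where A: "A \<in> \<A>" "fst p \<in> A" "fst q \<in> A"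
      using pbd_cover[OF assms(2) _ _ ne] by blast
    have "p \<in> A \<times> {0..2}" "q \<in> A \<times> {0..2}" using A p q by (auto simp: mem_Times_iff)
    then obtain B where "B \<in> \<G> A" "p \<in> B" "q \<in> B"
      using gdd3_cover[OF \<G>[OF A(1)] _ _ ne] by blast
    then show "\<exists>B\<in>\<Union>A\<in>\<A>. \<G> A. p \<in> B \<and> q \<in> B" using A(1) by blast
  next
    fix B C p q
    assume "B \<in> (\<Union>A\<in>\<A>. \<G> A)" "C \<in> (\<Union>A\<in>\<A>. \<G> A)"
      and p: "p \<in> B \<inter> C" and q: "q \<in> B \<inter> C" and ne: "p \<noteq> q"
    then obtain A A' where A: "A \<in> \<A>" "B \<in> \<G> A" and A': "A' \<in> \<A>" "C \<in> \<G> A'" by blast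
    have fst_ne: "fst p \<noteq> fst q"
      using block(3)[OF A] p q ne by (auto simp: inj_on_def)
    have "fst p \<in> A \<inter> A'" "fst q \<in> A \<inter> A'"
      using block(1)[OF A] block(1)[OF A'] p q by auto
    then have "A = A'" using pbd_unique[OF assms(2) A(1) A'(1)] fst_ne by blast
    then show "B = C" using gdd3_unique[OF \<G>[OF A(1)] A(2), of C] A'(2) p q ne by blast
  qed
  then show ?thesis using gdd3_orders_iff[OF assms(1)] by blast
qed

text \<open>
  A new point \<open>w\<close> is added to every group, which turns the groups into quadruples that cover the pairs
  left uncovered.
\<close>

lemma steiner_system_if_gdd3:
  assumes "r \<in> gdd3_orders"
  shows "\<exists>(X :: (nat \<times> int) set) \<A>. finite X \<and> card X = 3 * r + 1 \<and> pbd X \<A> \<and> (\<forall>A\<in>\<A>. card A = 4)"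
proof -
  obtain \<B> where gdd: "gdd3 {..<r} \<B>" using assms by (auto simp: gdd3_orders_def)
  define P where "P = {..<r} \<times> {0..2::int}"
  \<comment> \<open>The first coordinate \<open>r\<close> is outside \<open>{..<r}\<close>, so \<open>w\<close> is new.\<close>
  define w where "w = (r, 0::int)"
  define G where "G x = insert w ({x} \<times> {0..2::int})" for x :: nat
  have notin: "w \<notin> P" by (simp add: P_def w_def)
  have block: "B \<subseteq> P" "card B = 4" "inj_on fst B" if "B \<in> \<B>" for B
    using gdd3_block[OF gdd that] by (auto simp: P_def)
  have "finite P" "card P = 3 * r" by (simp_all add: P_def card_cartesian_product)
  then have X: "finite (insert w P)" "card (insert w P) = 3 * r + 1" using notin by auto
  have "pbd (insert w P) (\<B> \<union> G ` {..<r})"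
    unfolding pbd_def
  proof (intro conjI ballI allI impI)
    fix A assume "A \<in> \<B> \<union> G ` {..<r}"
    then show "A \<subseteq> insert w P" using block by (auto simp: G_def P_def)
  next
    fix p q assume p: "p \<in> insert w P" and q: "q \<in> insert w P" and ne: "p \<noteq> q"
    show "\<exists>A\<in>\<B> \<union> G ` {..<r}. p \<in> A \<and> q \<in> A"
    proof (cases "p \<in> P \<and> q \<in> P \<and> fst p \<noteq> fst q")
      case True
      then show ?thesis using gdd3_cover[OF gdd, of p q] unfolding P_def by blast
    next
      case False
      define x where "x = (if p = w then fst q else fst p)"
      have "x < r" "p \<in> G x" "q \<in> G x"
        using p q ne False by (auto simp: x_def G_def P_def)
      then show ?thesis by blast
    qed
  next
    have G: "p = w \<or> fst p = x" if "p \<in> G x" for p x using that by (auto simp: G_def)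
    have GG: "G x = G y" if "p \<in> G x \<inter> G y" "q \<in> G x \<inter> G y" "p \<noteq> q" for p q x y
      using that G by (metis IntE)
    have BG: "\<not> (p \<in> B \<inter> G x \<and> q \<in> B \<inter> G x)" if "B \<in> \<B>" "p \<noteq> q" for B p q x
      using block[OF that(1)] G[of p x] G[of q x] notin that(2) by (auto simp: inj_on_def)
    fix A A' p q
    assume "A \<in> \<B> \<union> G ` {..<r}" "A' \<in> \<B> \<union> G ` {..<r}"
      and "p \<in> A \<inter> A'" "q \<in> A \<inter> A'" "p \<noteq> q"
    then show "A = A'" using GG BG gdd3_unique[OF gdd] by (elim UnE imageE) blast+
  qed
  moreover have "card A = 4" if "A \<in> \<B> \<union> G ` {..<r}" for A
  proof -
    have "card (G x) = 4" if "x < r" for x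
      using that by (simp add: G_def w_def card_cartesian_product)
    then show ?thesis using that block by auto
  qed
  ultimately show ?thesis using X by blast
qed

lemma triple_plus_one_in_gdd3_orders:
  assumes "4 \<in> gdd3_orders" "r \<in> gdd3_orders"
  shows "3 * r + 1 \<in> gdd3_orders"
  using steiner_system_if_gdd3[OF assms(2)] card_in_gdd3_orders assms(1) by metis

section \<open>Explicit designs from cyclic starters\<close>

text \<open>
  Pigeonhole: if sets of size \<open>c\<close> cover \<open>P\<close> and their sizes add up to at most \<open>card P\<close>, no point can be
  covered twice. It turns the uniqueness part of a design into a count of blocks, which leaves only
  the covering of pairs to be checked on concrete designs.
\<close>

lemma disjoint_if_cover_tight:
  assumes fin: "finite P" "finite \<B>"
    and f: "\<And>B. B \<in> \<B> \<Longrightarrow> f B \<subseteq> P" "\<And>B. B \<in> \<B> \<Longrightarrow> card (f B) = c"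
    and cover: "P \<subseteq> (\<Union>B\<in>\<B>. f B)" and tight: "c * card \<B> \<le> card P"
    and BC: "B \<in> \<B>" "C \<in> \<B>" "B \<noteq> C"
  shows "f B \<inter> f C = {}"
proof (rule ccontr)
  assume "f B \<inter> f C \<noteq> {}"
  then obtain p where p: "p \<in> f B" "p \<in> f C" by blast
  let ?deg = "\<lambda>p. card {B \<in> \<B>. p \<in> f B}"
  have "card {p \<in> P. p \<in> f B} = c" if "B \<in> \<B>" for B
  proof -
    have "{p \<in> P. p \<in> f B} = f B" using f(1)[OF that] by blast
    then show ?thesis using f(2)[OF that] by simp
  qed
  then have "(\<Sum>p\<in>P. ?deg p) = c * card \<B>"
    using sum_multicount_gen[OF fin, of "\<lambda>p B. p \<in> f B" "\<lambda>_. c"] by simp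
  moreover have "(\<Sum>p\<in>P. 1) < (\<Sum>p\<in>P. ?deg p)"
  proof (rule sum_strict_mono_ex1[OF fin(1)])
    show "\<forall>p\<in>P. 1 \<le> ?deg p"
    proof
      fix p assume "p \<in> P"
      then have "{B \<in> \<B>. p \<in> f B} \<noteq> {}" using cover by blast
      then show "1 \<le> ?deg p" using fin(2) by (simp add: Suc_le_eq card_gt_0_iff)
    qed
    have "{B, C} \<subseteq> {B \<in> \<B>. p \<in> f B}" using BC p by blast
    then have "card {B, C} \<le> ?deg p" using fin(2) by (intro card_mono) auto
    then show "\<exists>p\<in>P. 1 < ?deg p" using BC p f(1)[OF BC(1)] by (intro bexI[of _ p]) auto
  qed
  ultimately show False using tight by simp
qed

lemma gdd3_if_cover_tight:
  assumes fin: "finite X" "finite \<B>"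
    and block: "\<And>B. B \<in> \<B> \<Longrightarrow> B \<subseteq> X \<times> {0..2}" "\<And>B. B \<in> \<B> \<Longrightarrow> card B = 4"
      "\<And>B. B \<in> \<B> \<Longrightarrow> inj_on fst B"
    and cover: "\<And>p q. p \<in> X \<times> {0..2} \<Longrightarrow> q \<in> X \<times> {0..2} \<Longrightarrow> fst p \<noteq> fst q \<Longrightarrow>
      \<exists>B\<in>\<B>. p \<in> B \<and> q \<in> B"
    and tight: "4 * card \<B> \<le> 3 * card X * (card X - 1)"
  shows "gdd3 X \<B>"
proof -
  \<comment> \<open>Ordered pairs of points are counted, twelve for each quadruple.\<close>
  define P where "P = (SIGMA p : X \<times> {0..2::int}. (X - {fst p}) \<times> {0..2::int})"
  define pairs where "pairs B = (SIGMA p : B. B - {p})" for B :: "('a \<times> int) set"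
  have finB: "finite B" if "B \<in> \<B>" for B
    using block(2)[OF that] by (simp add: card_ge_0_finite)
  have "pairs B \<subseteq> P" if "B \<in> \<B>" for B
    using block(1,3)[OF that] unfolding pairs_def P_def inj_on_def by fastforce
  moreover have "card (pairs B) = 12" if "B \<in> \<B>" for B
    using block(2)[OF that] finB[OF that] by (simp add: pairs_def)
  moreover have "P \<subseteq> (\<Union>B\<in>\<B>. pairs B)"
  proof
    fix z assume "z \<in> P"
    then obtain p q where z: "z = (p, q)" "p \<in> X \<times> {0..2}" "q \<in> X \<times> {0..2}" "fst p \<noteq> fst q"
      unfolding P_def by fastforce
    then obtain B where "B \<in> \<B>" "p \<in> B" "q \<in> B" using cover by blast
    then show "z \<in> (\<Union>B\<in>\<B>. pairs B)" using z by (auto simp: pairs_def)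
  qed
  moreover have "card P = 9 * card X * (card X - 1)"
  proof -
    have "card P = (\<Sum>p\<in>X \<times> {0..2::int}. card ((X - {fst p}) \<times> {0..2::int}))"
      unfolding P_def using fin(1) by (intro card_SigmaI) auto
    also have "\<dots> = (\<Sum>p\<in>X \<times> {0..2::int}. 3 * (card X - 1))"
      by (intro sum.cong refl) (auto simp: card_cartesian_product card_Diff_singleton)
    finally show ?thesis by (simp add: card_cartesian_product)
  qed
  moreover have "finite P" using fin(1) by (simp add: P_def)
  ultimately have disj: "pairs B \<inter> pairs C = {}" if "B \<in> \<B>" "C \<in> \<B>" "B \<noteq> C" for B C
    using disjoint_if_cover_tight[of P \<B> pairs 12 B C] fin(2) that tight by simp
  show ?thesis
    unfolding gdd3_def
  proof (intro conjI ballI allI impI)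
    fix B C p q
    assume "B \<in> \<B>" "C \<in> \<B>" "p \<in> B \<inter> C" "q \<in> B \<inter> C" "p \<noteq> q"
    then have "(p, q) \<in> pairs B \<inter> pairs C" by (auto simp: pairs_def)
    then show "B = C" using disj \<open>B \<in> \<B>\<close> \<open>C \<in> \<B>\<close> by blast
  next
    fix p q :: "'a \<times> int"
    assume "p \<in> X \<times> {0..2}" "q \<in> X \<times> {0..2}" "fst p \<noteq> fst q"
    then show "\<exists>B\<in>\<B>. p \<in> B \<and> q \<in> B" by (rule cover)
  qed (use block in simp_all)
qed

text \<open>
  The translations of \<open>Z\<^sub>m \<times> Z\<^sub>3\<close>, where \<open>m\<close> serves as an additional first coordinate that is fixed,
  the point at infinity.
\<close>

definition move :: "int \<Rightarrow> int \<Rightarrow> int \<Rightarrow> int \<times> int \<Rightarrow> int \<times> int" where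
  "move m s u = (\<lambda>(x, i). (if x = m then m else (x + s) mod m, (i + u) mod 3))"

lemma fst_move: "fst (move m s u p) = (if fst p = m then m else (fst p + s) mod m)"
  and snd_move: "snd (move m s u p) = (snd p + u) mod 3"
  by (simp_all add: move_def split: prod.split)

text \<open>
  A pair of points is determined up to translation by the difference of the first coordinates and a
  key computed from the second coordinates \<open>i\<close> and \<open>j\<close>. If \<open>tw\<close> holds, translations act on both
  coordinates and only \<open>j - i\<close> matters; otherwise they act on the first one only.
\<close>

definition difference_key :: "bool \<Rightarrow> int \<Rightarrow> int \<Rightarrow> int \<times> int" where
  "difference_key tw i j = (if tw then (0, (j - i) mod 3) else (i, j))"

text \<open>
  The first entry \<open>m\<close> encodes the difference between a finite point and the point at infinity.
\<close>

definition differences :: "bool \<Rightarrow> int \<Rightarrow> (int \<times> int) list list \<Rightarrow> (int \<times> int \<times> int) list" where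
  "differences tw m F =
     [(if x = m then m else (y - x) mod m, difference_key tw i j).
        B \<leftarrow> F, (x, i) \<leftarrow> B, (y, j) \<leftarrow> B, x \<noteq> y \<and> y < m]"

text \<open>
  A family \<open>F\<close> of base blocks whose translates cover every pair, and which is so small that they
  cannot cover a pair twice. The order \<open>r\<close> is \<open>m\<close> without and \<open>m + 1\<close> with a point at infinity. All
  conditions can be evaluated.
\<close>

definition starter :: "bool \<Rightarrow> int \<Rightarrow> int \<Rightarrow> (int \<times> int) list list \<Rightarrow> bool" where
  "starter tw m r F \<longleftrightarrow>
     0 < m \<and> (r = m \<or> r = m + 1) \<and> 4 * (m * (if tw then 3 else 1) * int (length F)) \<le> 3 * r * (r - 1) \<and>
     (\<forall>B\<in>set F. length B = 4 \<and> distinct (map fst B) \<and>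
       (\<forall>p\<in>set B. 0 \<le> fst p \<and> fst p < r \<and> 0 \<le> snd p \<and> snd p \<le> 2)) \<and>
     set [(d, i, j). d \<leftarrow> [1..r - 1], i \<leftarrow> (if tw then [0] else [0..2]), j \<leftarrow> [0..2]]
       \<subseteq> set (differences tw m F)"

text \<open>
  The pairs fall into orbits under translation, and the differences name the orbits. As the base
  blocks meet every orbit, their translates cover every pair; the bound on the number of base blocks
  then makes \<open>gdd3_if_cover_tight\<close> applicable.
\<close>

lemma starter_in_gdd3_orders:
  assumes "starter tw m r F"
  shows "nat r \<in> gdd3_orders"
proof -
  have m: "0 < m" and r: "r = m \<or> r = m + 1"
    and size: "4 * (m * (if tw then 3 else 1) * int (length F)) \<le> 3 * r * (r - 1)"
    using assms unfolding starter_def by blast+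
  have block: "length B = 4" "distinct (map fst B)" "set B \<subseteq> {0..<r} \<times> {0..2}" if "B \<in> set F" for B
  proof -
    have B: "length B = 4 \<and> distinct (map fst B) \<and>
        (\<forall>p\<in>set B. 0 \<le> fst p \<and> fst p < r \<and> 0 \<le> snd p \<and> snd p \<le> 2)"
      using assms that unfolding starter_def by blast
    then show "length B = 4" "distinct (map fst B)" by blast+
    show "set B \<subseteq> {0..<r} \<times> {0..2}" using B by (auto simp: mem_Times_iff)
  qed
  have diff: "(d, difference_key tw i j) \<in> set (differences tw m F)"
    if "d \<in> {1..<r}" "i \<in> {0..2}" "j \<in> {0..2}" for d i j
  proof -
    have "(j - i) mod 3 \<le> 2" using pos_mod_bound[of 3 "j - i"] by linarith
    then have "(d, difference_key tw i j) \<in>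
        set [(d, i, j). d \<leftarrow> [1..r - 1], i \<leftarrow> (if tw then [0] else [0..2]), j \<leftarrow> [0..2]]"
      using that by (simp add: difference_key_def image_iff)
    then show ?thesis using assms unfolding starter_def by blast
  qed
  define U where "U = (if tw then {0..2::int} else {0})"
  define \<B> where "\<B> = (\<lambda>(s, u, B). move m s u ` set B) ` ({0..<m} \<times> U \<times> set F)"
  have move_fst: "fst (move m s u p) = fst (move m s u q) \<longleftrightarrow> fst p = fst q"
    if "p \<in> {0..<r} \<times> {0..2}" "q \<in> {0..<r} \<times> {0..2}" for p q s u
  proof -
    have less: "fst z < m" if "z \<in> {0..<r} \<times> {0..2::int}" "fst z \<noteq> m" for z
      using that r by (auto simp: mem_Times_iff)
    have not_m: "(z + s) mod m \<noteq> m" for z using pos_mod_bound[OF m, of "z + s"] by linarith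
    have "(fst p + s) mod m = (fst q + s) mod m \<longleftrightarrow> fst p = fst q"
      if "fst p \<noteq> m" "fst q \<noteq> m"
    proof -
      have "[fst p + s = fst q + s] (mod m) \<longleftrightarrow> [fst p = fst q] (mod m)" by (rule cong_add_rcancel)
      moreover have "fst p < m" "fst q < m" "0 \<le> fst p" "0 \<le> fst q"
        using less \<open>p \<in> _\<close> \<open>q \<in> _\<close> that by (auto simp: mem_Times_iff)
      ultimately show ?thesis by (simp add: cong_def)
    qed
    then show ?thesis
      unfolding fst_move using not_m[of "fst p"] not_m[of "fst q", symmetric]
      by (cases "fst p = m"; cases "fst q = m") simp_all
  qed
  have "gdd3 {0..<r} \<B>"
  proof (rule gdd3_if_cover_tight)
    show "finite {0..<r}" "finite \<B>" by (simp_all add: \<B>_def U_def)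
  next
    fix C assume "C \<in> \<B>"
    then obtain s u B where B: "B \<in> set F" and C: "C = move m s u ` set B" by (auto simp: \<B>_def)
    note sub = block(3)[OF B]
    show "C \<subseteq> {0..<r} \<times> {0..2}"
    proof
      fix z assume "z \<in> C"
      then obtain p where p: "p \<in> set B" "z = move m s u p" unfolding C by blast
      have "fst p < r" using sub p(1) by auto
      then have "fst z \<in> {0..<r}" "snd z \<in> {0..2}"
        using m r pos_mod_bound[OF m, of "fst p + s"] pos_mod_sign[OF m, of "fst p + s"]
        unfolding p(2) fst_move snd_move by auto
      then show "z \<in> {0..<r} \<times> {0..2}" by (simp add: mem_Times_iff)
    qed
    have fst_B: "inj_on fst (set B)" "card (set B) = 4"
      using block(1,2)[OF B] distinct_card[of B] by (auto simp: distinct_map)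
    have "inj_on (fst \<circ> move m s u) (set B)"
    proof (rule inj_onI)
      fix p q assume pq: "p \<in> set B" "q \<in> set B" and "(fst \<circ> move m s u) p = (fst \<circ> move m s u) q"
      then have "fst p = fst q" using move_fst[of p q s u] sub by auto
      then show "p = q" using pq by (rule inj_onD[OF fst_B(1)])
    qed
    then show "inj_on fst C" "card C = 4"
      unfolding C using fst_B(2) inj_on_imageI[of fst "move m s u"] inj_on_imageI2[of fst "move m s u"]
      by (blast, simp add: card_image)
  next
    \<comment> \<open>The translation is chosen so that it moves a pair with the right difference in a base block to
      the given pair. The second point is assumed finite, as is at least one point of each pair.\<close>
    have covered: "\<exists>C\<in>\<B>. (a, i) \<in> C \<and> (b, j) \<in> C"
      if a: "a \<in> {0..<r}" and b: "b \<in> {0..<m}" and "a \<noteq> b" and ij: "i \<in> {0..2}" "j \<in> {0..2}" for a b i j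
    proof -
      define d where "d = (if a = m then m else (b - a) mod m)"
      have am: "a < m" if "a \<noteq> m" using a that r by auto
      have "d \<in> {1..<r}"
      proof (cases "a = m")
        case False
        have "\<not> [b = a] (mod m)" using am[OF False] a b \<open>a \<noteq> b\<close> by (auto simp: cong_def)
        then have "(b - a) mod m \<noteq> 0" by (simp add: cong_iff_dvd_diff dvd_eq_mod_eq_0)
        then show ?thesis
          using False m r pos_mod_bound[OF m, of "b - a"] pos_mod_sign[OF m, of "b - a"] unfolding d_def
          by auto
      qed (use a m in \<open>simp add: d_def\<close>)
      from diff[OF this ij] obtain B x i0 y j0 where B: "B \<in> set F" "(x, i0) \<in> set B" "(y, j0) \<in> set B"
        and y: "y < m" and d: "d = (if x = m then m else (y - x) mod m)"
        and key: "difference_key tw i j = difference_key tw i0 j0"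
        unfolding differences_def by (auto split: if_splits)
      have range: "i0 \<in> {0..2}" "j0 \<in> {0..2}" using block(3)[OF B(1)] B(2,3) by auto
      define s where "s = (b - y) mod m"
      define u where "u = (if tw then (i - i0) mod 3 else 0)"
      have "(b - a) mod m \<noteq> m" "(y - x) mod m \<noteq> m"
        using pos_mod_bound[OF m, of "b - a"] pos_mod_bound[OF m, of "y - x"] by linarith+
      then have "a = m \<longleftrightarrow> x = m" using d unfolding d_def by (cases "a = m"; cases "x = m") simp_all
      moreover have "(x + s) mod m = a" if "a \<noteq> m" "x \<noteq> m"
      proof -
        have "[b - a = y - x] (mod m)" using d that by (simp add: d_def cong_def)
        from cong_diff[OF cong_refl[of b] this] have "[a = x + (b - y)] (mod m)"
          by (simp add: algebra_simps)
        then show ?thesis using am[OF that(1)] a by (simp add: s_def cong_def mod_simps)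
      qed
      moreover have "(y + s) mod m = b" using b by (simp add: s_def mod_simps)
      moreover have "(i0 + u) mod 3 = i \<and> (j0 + u) mod 3 = j"
      proof (cases tw)
        case True
        then have "[j - i = j0 - i0] (mod 3)" using key by (simp add: difference_key_def cong_def)
        from cong_add[OF this cong_refl[of i]] have "[j0 + (i - i0) = j] (mod 3)"
          by (simp add: algebra_simps cong_sym_eq)
        then show ?thesis using ij True by (simp add: u_def cong_def mod_simps)
      next
        case False
        then show ?thesis using key ij range by (simp add: difference_key_def u_def)
      qed
      ultimately have "(a, i) = move m s u (x, i0)" "(b, j) = move m s u (y, j0)"
        using y by (auto simp: move_def)
      moreover have "move m s u ` set B \<in> \<B>"
        unfolding \<B>_def using B(1) m by (intro image_eqI[of _ _ "(s, u, B)"]) (auto simp: s_def u_def U_def)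
      ultimately show ?thesis using B(2,3) by blast
    qed
    fix p q :: "int \<times> int"
    assume p: "p \<in> {0..<r} \<times> {0..2}" and q: "q \<in> {0..<r} \<times> {0..2}" and ne: "fst p \<noteq> fst q"
    have r': "z \<in> {0..<m}" if "z \<in> {0..<r}" "z \<noteq> m" for z using that r by auto
    have range: "fst p \<in> {0..<r}" "fst q \<in> {0..<r}" "snd p \<in> {0..2}" "snd q \<in> {0..2}"
      using p q by (simp_all add: mem_Times_iff)
    show "\<exists>C\<in>\<B>. p \<in> C \<and> q \<in> C"
    proof (cases "fst q = m")
      case True
      then have "fst p \<in> {0..<m}" using r' range(1) ne by simp
      from covered[OF range(2) this ne[symmetric] range(4,3)] show ?thesis by (simp add: conj_commute)
    next
      case False
      from covered[OF range(1) r'[OF range(2) False] ne range(3,4)] show ?thesis by simp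
    qed
  next
    have "card \<B> \<le> card ({0..<m} \<times> U \<times> set F)"
      unfolding \<B>_def by (intro card_image_le) (simp add: U_def)
    also have "\<dots> = nat m * (card U * card (set F))" by (simp add: card_cartesian_product)
    also have "\<dots> \<le> nat m * (card U * length F)" by (intro mult_le_mono le_refl card_length)
    finally have "int (card \<B>) \<le> int (nat m * (card U * length F))" by (simp only: of_nat_le_iff)
    also have "\<dots> = m * (if tw then 3 else 1) * int (length F)"
      using m by (simp add: U_def)
    finally have "4 * int (card \<B>) \<le> 3 * r * (r - 1)" using size by linarith
    also have "3 * r * (r - 1) = int (3 * nat r * (nat r - 1))"
      using m r by (auto simp: of_nat_diff)
    finally have "int (4 * card \<B>) \<le> int (3 * nat r * (nat r - 1))" by (simp only: of_nat_mult of_nat_numeral)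
    then have "4 * card \<B> \<le> 3 * nat r * (nat r - 1)" by (rule of_nat_le_iff[THEN iffD1])
    then show "4 * card \<B> \<le> 3 * card {0..<r} * (card {0..<r} - 1)" by simp
  qed
  then show ?thesis using gdd3_orders_iff[of "{0..<r}"] by auto
qed

text \<open>
  The base blocks were found by computer search. For 41 the search was restricted to families
  invariant under multiplication of the first coordinate by 10, which has order 5 modulo 41. For 44
  multiplication by 6, of order 3 modulo 43, fixes the first two base blocks and permutes the others,
  up to translation of their finite points.
\<close>

lemma starter_5: "starter True 5 5
    [[(0, 0), (4, 2), (2, 0), (3, 2)]]"
  unfolding starter_def by code_simp

lemma starter_8: "starter True 7 8
    [[(7, 0), (0, 0), (1, 1), (5, 2)],
     [(0, 0), (6, 1), (3, 1), (5, 1)]]"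
  unfolding starter_def by code_simp

lemma starter_9: "starter False 9 9
    [[(0, 0), (1, 0), (3, 0), (7, 1)],
     [(0, 0), (1, 1), (5, 0), (7, 2)],
     [(0, 0), (4, 2), (5, 2), (8, 2)],
     [(0, 0), (3, 1), (6, 2), (8, 1)],
     [(0, 0), (1, 2), (2, 1), (3, 2)],
     [(0, 1), (1, 1), (3, 1), (5, 2)]]"
  unfolding starter_def by code_simp

lemma starter_12: "starter True 11 12
    [[(11, 0), (0, 0), (8, 1), (1, 2)],
     [(0, 0), (2, 0), (3, 1), (9, 1)],
     [(0, 0), (9, 2), (3, 0), (4, 0)]]"
  unfolding starter_def by code_simp

lemma starter_17: "starter True 17 17
    [[(0, 0), (1, 0), (4, 2), (16, 2)],
     [(0, 0), (16, 1), (7, 2), (10, 0)],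
     [(0, 0), (3, 0), (11, 0), (15, 1)],
     [(0, 0), (9, 1), (5, 1), (15, 0)]]"
  unfolding starter_def by code_simp

lemma starter_41: "starter True 41 41
    [[(0, 0), (32, 1), (17, 1), (9, 1)],
     [(0, 0), (33, 1), (6, 1), (8, 1)],
     [(0, 0), (2, 1), (19, 1), (39, 1)],
     [(0, 0), (20, 1), (26, 1), (21, 1)],
     [(0, 0), (36, 1), (14, 1), (5, 1)],
     [(0, 0), (3, 0), (28, 2), (38, 1)],
     [(0, 0), (30, 0), (34, 2), (11, 1)],
     [(0, 0), (13, 0), (12, 2), (28, 1)],
     [(0, 0), (7, 0), (38, 2), (34, 1)],
     [(0, 0), (29, 0), (11, 2), (12, 1)]]"
  unfolding starter_def by code_simp

lemma starter_44: "starter True 43 44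
    [[(43, 0), (1, 0), (6, 1), (36, 2)],
     [(0, 0), (1, 0), (6, 0), (36, 0)],
     [(0, 0), (1, 1), (2, 0), (4, 1)],
     [(0, 0), (6, 1), (12, 0), (24, 1)],
     [(0, 0), (36, 1), (29, 0), (15, 1)],
     [(0, 0), (2, 2), (11, 2), (28, 0)],
     [(0, 0), (12, 2), (23, 2), (39, 0)],
     [(0, 0), (29, 2), (9, 2), (19, 0)],
     [(0, 0), (3, 1), (13, 1), (22, 2)],
     [(0, 0), (18, 1), (35, 1), (3, 2)],
     [(0, 0), (22, 1), (38, 1), (18, 2)]]"
  unfolding starter_def by code_simp

text \<open>
  For order 4 the quadruples are the nine lines over \<open>Z\<^sub>3\<close>: the affine functions on \<open>{0, 1, 2}\<close>, with the
  slope as the fourth entry.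
\<close>

lemma four_in_gdd3_orders: "4 \<in> gdd3_orders"
proof -
  define Bs :: "(int \<times> int) list list" where
    "Bs = [[(0, a), (1, (a + b) mod 3), (2, (a + 2 * b) mod 3), (3, b)]. a \<leftarrow> [0..2], b \<leftarrow> [0..2]]"
  have block: "list_all (\<lambda>B. length B = 4 \<and> distinct (map fst B) \<and>
      list_all (\<lambda>p. 0 \<le> fst p \<and> fst p < 4 \<and> 0 \<le> snd p \<and> snd p \<le> 2) B) Bs"
    unfolding Bs_def by code_simp
  have cover: "set [((x, i), (y, j)). x \<leftarrow> [0..3], y \<leftarrow> [0..3], x \<noteq> y, i \<leftarrow> [0..2], j \<leftarrow> [0..2]]
      \<subseteq> set [(p, q). B \<leftarrow> Bs, p \<leftarrow> B, q \<leftarrow> B]"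
    unfolding Bs_def by code_simp
  have "gdd3 {0..<4} (set ` set Bs)"
  proof (rule gdd3_if_cover_tight)
    fix C assume "C \<in> set ` set Bs"
    then obtain B where B: "B \<in> set Bs" "C = set B" by blast
    then have props: "length B = 4" "distinct (map fst B)"
        "\<And>p. p \<in> set B \<Longrightarrow> 0 \<le> fst p \<and> fst p < 4 \<and> 0 \<le> snd p \<and> snd p \<le> 2"
      using block by (simp_all add: list_all_iff)
    show "C \<subseteq> {0..<4} \<times> {0..2}"
      unfolding B(2) using props(3) by (intro subsetI) (simp add: mem_Times_iff)
    show "card C = 4" "inj_on fst C"
      unfolding B(2) using distinct_card[of B] props(1,2) by (simp_all add: distinct_map)
  next
    fix p q :: "int \<times> int"
    assume "p \<in> {0..<4} \<times> {0..2}" "q \<in> {0..<4} \<times> {0..2}" "fst p \<noteq> fst q"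
    then have "(p, q) \<in> set [((x, i), (y, j)).
        x \<leftarrow> [0..3], y \<leftarrow> [0..3], x \<noteq> y, i \<leftarrow> [0..2], j \<leftarrow> [0..2]]"
      by (cases p; cases q) (simp add: image_iff)
    then have "(p, q) \<in> set [(p, q). B \<leftarrow> Bs, p \<leftarrow> B, q \<leftarrow> B]" using cover by blast
    then show "\<exists>C\<in>set ` set Bs. p \<in> C \<and> q \<in> C" by auto
  next
    have "card (set ` set Bs) \<le> card (set Bs)" by (rule card_image_le) simp
    also have "\<dots> \<le> length Bs" by (rule card_length)
    also have "length Bs = 9" unfolding Bs_def by code_simp
    finally show "4 * card (set ` set Bs) \<le> 3 * card {0..<4::int} * (card {0..<4::int} - 1)" by simp
  qed simp_all
  then show ?thesis using gdd3_orders_iff[of "{0..<4::int}"] by auto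
qed

section \<open>Truncated transversal designs\<close>

text \<open>
  Two columns \<open>c\<close> and \<open>d\<close> determine the slope by \<open>(d - c) b = y - x\<close>. The differences of distinct numbers
  in \<open>{0..3}\<close> are \<open>\<plusminus>1, \<plusminus>2, \<plusminus>3\<close>, which explains the hypothesis that \<open>t\<close> is coprime to 6.
\<close>

lemma transversal_line_unique:
  fixes t :: int
  assumes t: "coprime t 6" "0 < t" and c: "c \<in> {0..3}" and d: "d \<in> {0..3}" and "c \<noteq> d"
    and x: "x \<in> {0..<t}" and y: "y \<in> {0..<t}"
  shows "\<exists>!(a, b). a \<in> {0..<t} \<and> b \<in> {0..<t} \<and> x = (a + c * b) mod t \<and> y = (a + d * b) mod t"
proof -
  have cop: "coprime t 2" "coprime t 3"
    using t(1) coprime_mult_right_iff[of t 2 3] by auto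
  have "d - c \<in> {-3, -2, -1, 1, 2, 3}" using c d \<open>c \<noteq> d\<close> by auto
  then have unit: "coprime (d - c) t" using cop by (auto simp: coprime_commute)
  then obtain u where u: "[(d - c) * u = 1] (mod t)"
    using cong_solve_coprime_int by blast
  define b where "b = (u * (y - x)) mod t"
  define a where "a = (x - c * b) mod t"
  have "[(d - c) * b = y - x] (mod t)"
  proof -
    have "[(d - c) * b = (d - c) * (u * (y - x))] (mod t)"
      unfolding b_def by (intro cong_mult cong_refl) (simp add: cong_def)
    also have "(d - c) * (u * (y - x)) = (d - c) * u * (y - x)" by simp
    also have "[\<dots> = 1 * (y - x)] (mod t)" by (intro cong_mult u cong_refl)
    finally show ?thesis by simp
  qed
  then have slope: "[x + (d - c) * b = y] (mod t)" by (metis cong_add_lcancel add_diff_cancel_left' diff_add_cancel add.commute)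
  have a: "[a = x - c * b] (mod t)" by (simp add: a_def cong_def)
  have "[a + c * b = x] (mod t)" using cong_add[OF a cong_refl[of "c * b"]] by simp
  then have xa: "x = (a + c * b) mod t" using x by (simp add: cong_def)
  have "[a + d * b = x + (d - c) * b] (mod t)"
    using cong_add[OF a cong_refl[of "d * b"]] by (simp add: algebra_simps)
  then have ya: "y = (a + d * b) mod t" using slope y by (simp add: cong_def)
  have "a' = a \<and> b' = b"
    if a': "a' \<in> {0..<t}" "b' \<in> {0..<t}" "x = (a' + c * b') mod t" "y = (a' + d * b') mod t" for a' b'
  proof -
    have 1: "[a' + c * b' = a + c * b] (mod t)" "[a' + d * b' = a + d * b] (mod t)"
      using xa ya a' by (auto simp: cong_def)
    have "[(d - c) * b' = (d - c) * b] (mod t)"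
      using cong_diff[OF 1(2) 1(1)] by (simp add: algebra_simps)
    then have "[b' = b] (mod t)" using cong_mult_lcancel[OF unit] by blast
    then have bb: "b' = b" using a'(2) t(2) by (simp add: cong_def b_def)
    then have "[a' = a] (mod t)" using 1(1) by (simp add: cong_add_rcancel)
    then show ?thesis using a'(1) t(2) bb by (simp add: cong_def a_def)
  qed
  moreover have "a \<in> {0..<t}" "b \<in> {0..<t}" using t(2) by (auto simp: a_def b_def)
  ultimately show ?thesis using xa ya by (intro ex1I[of _ "(a, b)"]) auto
qed

text \<open>
  The line with intercept \<open>a\<close> and slope \<open>b\<close> has the value \<open>a + c b\<close> in column \<open>c \<in> {0..3}\<close> and the
  slope \<open>b\<close> in column 4, where it is dropped unless \<open>b < h\<close>. Two points in distinct columns lie on one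
  line; two points in one column lie in the column. A point at infinity, present if \<open>e = 1\<close>, is
  added to all columns.
\<close>

lemma truncated_transversal_in_gdd3_orders:
  fixes t h e :: nat
  assumes t: "coprime t 6" "0 < t" and h: "h \<le> t" and e: "e \<le> 1"
    and orders: "4 \<in> gdd3_orders" "5 \<in> gdd3_orders" "t + e \<in> gdd3_orders" "h + e \<in> gdd3_orders"
  shows "4 * t + h + e \<in> gdd3_orders"
proof -
  define T where "T = {0..<int t}"
  define H where "H = {0..<int h}"
  define E where "E = (if e = 1 then {(5 :: int, 0 :: int)} else {})"
  define X where "X = {0..3 :: int} \<times> T \<union> {4} \<times> H \<union> E"
  define line where "line a b = (\<lambda>c. (c :: int, (a + c * b) mod int t)) ` {0..3} \<union> {4} \<times> (H \<inter> {b})" for a b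
  define group where "group c = {c :: int} \<times> (if c = 4 then H else T) \<union> E" for c
  define \<L> where "\<L> = {line a b |a b. a \<in> T \<and> b \<in> T}"
  define \<G> where "\<G> = group ` {0..4}"
  have fin: "finite T" "finite H" "finite E" by (simp_all add: T_def H_def E_def)
  have HT: "H \<subseteq> T" using h by (auto simp: H_def T_def)
  have card: "card T = t" "card H = h" "card E = e"
    using e by (auto simp: T_def H_def E_def)
  have E_eq: "p = q" if "p \<in> E" "q \<in> E" for p q
    using that by (auto simp: E_def split: if_splits)
  have E_fst: "fst p = 5" if "p \<in> E" for p
    using that by (auto simp: E_def split: if_splits)
  have disj: "({0..3} \<times> T \<union> {4} \<times> H) \<inter> E = {}" "({c} \<times> S) \<inter> E = {}" if "c \<in> {0..4}" for c S
    using E_fst that by fastforce+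
  have X: "finite X" "card X = 4 * t + h + e"
  proof -
    have "card ({0..3 :: int} \<times> T \<union> {4} \<times> H) = 4 * t + h"
      using fin card by (subst card_Un_disjoint) (auto simp: card_cartesian_product)
    then show "card X = 4 * t + h + e"
      unfolding X_def using fin card disj(1)[of 0] by (subst card_Un_disjoint) simp_all
  qed (use fin in \<open>simp add: X_def\<close>)
  have mem_line: "(c, x) \<in> line a b \<longleftrightarrow>
      c \<in> {0..3} \<and> x = (a + c * b) mod int t \<or> c = 4 \<and> x = b \<and> b \<in> H" for c x a b
    by (auto simp: line_def)
  have mem_X: "(c, x) \<in> X \<longleftrightarrow> c \<in> {0..3} \<and> x \<in> T \<or> c = 4 \<and> x \<in> H \<or> (c, x) \<in> E" for c x
    by (auto simp: X_def)
  have mem_group: "p \<in> group c \<longleftrightarrow> (fst p = c \<and> snd p \<in> (if c = 4 then H else T)) \<or> p \<in> E" for p c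
    by (cases p) (auto simp: group_def)
  \<comment> \<open>If the second column is the slope column, the slope is given and only the intercept is solved for.\<close>
  have two_points: "\<exists>a\<in>T. \<exists>b\<in>T. (c, x) \<in> line a b \<and> (d, y) \<in> line a b \<and>
      (\<forall>a'\<in>T. \<forall>b'\<in>T. (c, x) \<in> line a' b' \<longrightarrow> (d, y) \<in> line a' b' \<longrightarrow> a' = a \<and> b' = b)"
    if "c < d" "(c, x) \<in> X" "(d, y) \<in> X" "(c, x) \<notin> E" "(d, y) \<notin> E" for c d x y
  proof (cases "d = 4")
    case True
    then have c: "c \<in> {0..3}" "x \<in> T" "y \<in> H" using that by (auto simp: mem_X)
    define a where "a = (x - c * y) mod int t"
    have xa: "x = (a + c * y) mod int t" using c(2) by (simp add: a_def T_def mod_simps)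
    have aT: "a \<in> T" and yT: "y \<in> T" using t(2) c(3) HT by (auto simp: a_def T_def)
    show ?thesis
    proof (rule bexI[OF _ aT], rule bexI[OF _ yT], intro conjI ballI impI)
      show "(c, x) \<in> line a y" "(d, y) \<in> line a y"
        unfolding mem_line using c xa True by simp_all
      fix a' b' assume a': "a' \<in> T" and "(c, x) \<in> line a' b'" "(d, y) \<in> line a' b'"
      then show b': "b' = y" unfolding mem_line using True by simp
      have "x = (a' + c * b') mod int t"
        using \<open>(c, x) \<in> line a' b'\<close> c(1) unfolding mem_line by auto
      then have "[a' + c * y = a + c * y] (mod int t)" using xa b' by (simp add: cong_def)
      then have "[a' = a] (mod int t)" by (simp add: cong_add_rcancel)
      then show "a' = a" using a' t(2) by (simp add: cong_def a_def T_def)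
    qed
  next
    case False
    then have cd: "c \<in> {0..3}" "d \<in> {0..3}" "x \<in> T" "y \<in> T"
      using that HT by (auto simp: mem_X)
    have "coprime (int t) 6" using t(1) by (metis coprime_int_iff of_nat_numeral)
    then have "\<exists>!(a, b). a \<in> T \<and> b \<in> T \<and> x = (a + c * b) mod int t \<and> y = (a + d * b) mod int t"
      unfolding T_def using cd that(1) t(2) by (intro transversal_line_unique) (auto simp: T_def)
    then obtain a b where ab: "a \<in> T" "b \<in> T" "x = (a + c * b) mod int t" "y = (a + d * b) mod int t"
      and uniq: "\<And>a' b'. a' \<in> T \<Longrightarrow> b' \<in> T \<Longrightarrow> x = (a' + c * b') mod int t \<Longrightarrow>
        y = (a' + d * b') mod int t \<Longrightarrow> a' = a \<and> b' = b"
      by (elim ex1E) blast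
    show ?thesis
    proof (rule bexI[OF _ ab(1)], rule bexI[OF _ ab(2)], intro conjI ballI impI)
      show "(c, x) \<in> line a b" "(d, y) \<in> line a b"
        unfolding mem_line using cd ab by simp_all
      fix a' b' assume "a' \<in> T" "b' \<in> T" "(c, x) \<in> line a' b'" "(d, y) \<in> line a' b'"
      then show "a' = a" "b' = b" unfolding mem_line using cd uniq[of a' b'] by auto
    qed
  qed
  have line_sub: "line a b \<subseteq> X" if "a \<in> T" "b \<in> T" for a b
    using that t(2) by (auto simp: line_def X_def T_def)
  have line_E: "p \<notin> E" if "p \<in> line a b" for p a b
    using that E_fst[of p] by (auto simp: line_def)
  have line_fst: "p = q" if "p \<in> line a b" "q \<in> line a b" "fst p = fst q" for p q a b
    using that by (auto simp: line_def)
  have group_sub: "group c \<subseteq> X" if "c \<in> {0..4}" for c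
    using that by (auto simp: group_def X_def)
  have line_exists: "\<exists>a\<in>T. \<exists>b\<in>T. p \<in> line a b \<and> q \<in> line a b"
    if "fst p < fst q" "p \<in> X" "q \<in> X" "p \<notin> E" "q \<notin> E" for p q
    using two_points[of "fst p" "fst q" "snd p" "snd q"] that unfolding prod.collapse by blast
  have line_unique: "line a b = line a' b'"
    if "fst p < fst q" "a \<in> T" "b \<in> T" "a' \<in> T" "b' \<in> T"
      "p \<in> line a b" "q \<in> line a b" "p \<in> line a' b'" "q \<in> line a' b'" for p q a b a' b'
  proof -
    have "p \<in> X" "q \<in> X" "p \<notin> E" "q \<notin> E"
      using line_sub[of a b] line_E[of p a b] line_E[of q a b] that by auto
    from two_points[of "fst p" "fst q" "snd p" "snd q", unfolded prod.collapse, OF that(1) this]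
    obtain a0 b0 where "\<And>a b. a \<in> T \<Longrightarrow> b \<in> T \<Longrightarrow> p \<in> line a b \<Longrightarrow> q \<in> line a b \<Longrightarrow> a = a0 \<and> b = b0"
      by blast
    from this[of a b] this[of a' b'] show ?thesis using that by simp
  qed
  have own_group: "fst p \<in> {0..4} \<and> p \<in> group (fst p)" if "p \<in> X" "p \<notin> E" for p
    using that by (cases p) (auto simp: X_def group_def)
  have pbd: "pbd X (\<L> \<union> \<G>)"
    unfolding pbd_def
  proof (intro conjI ballI allI impI)
    fix A assume "A \<in> \<L> \<union> \<G>"
    then show "A \<subseteq> X" using line_sub group_sub unfolding \<L>_def \<G>_def by blast
  next
    fix p q assume p: "p \<in> X" and q: "q \<in> X" and ne: "p \<noteq> q"
    show "\<exists>A\<in>\<L> \<union> \<G>. p \<in> A \<and> q \<in> A"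
    proof (cases "p \<in> E \<or> q \<in> E \<or> fst p = fst q")
      case True
      have "p \<notin> E \<or> q \<notin> E" using E_eq ne by blast
      then have "\<exists>c\<in>{0..4}. p \<in> group c \<and> q \<in> group c"
      proof
        assume "p \<notin> E"
        then have "q \<in> group (fst p)" using own_group[OF q] True by (cases "q \<in> E") (simp_all add: group_def)
        then show ?thesis using own_group[OF p \<open>p \<notin> E\<close>] by blast
      next
        assume "q \<notin> E"
        then have "p \<in> group (fst q)" using own_group[OF p] True by (cases "p \<in> E") (simp_all add: group_def)
        then show ?thesis using own_group[OF q \<open>q \<notin> E\<close>] by blast
      qed
      then show ?thesis unfolding \<G>_def by blast
    next
      case False
      then have "fst p < fst q \<or> fst q < fst p" by auto
      then have "\<exists>a\<in>T. \<exists>b\<in>T. p \<in> line a b \<and> q \<in> line a b"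
        using line_exists[of p q] line_exists[of q p] False p q by blast
      then show ?thesis unfolding \<L>_def by blast
    qed
  next
    have LL: "A = A'" if "A \<in> \<L>" "A' \<in> \<L>" "p \<in> A \<inter> A'" "q \<in> A \<inter> A'" "p \<noteq> q" for A A' p q
    proof -
      obtain a b a' b' where ab: "A = line a b" "a \<in> T" "b \<in> T" "A' = line a' b'" "a' \<in> T" "b' \<in> T"
        using \<open>A \<in> \<L>\<close> \<open>A' \<in> \<L>\<close> by (auto simp: \<L>_def)
      have in_line: "p \<in> line a b" "p \<in> line a' b'" "q \<in> line a b" "q \<in> line a' b'"
        using that ab by auto
      have "fst p \<noteq> fst q" using line_fst in_line \<open>p \<noteq> q\<close> by blast
      then have "fst p < fst q \<or> fst q < fst p" by auto
      then show ?thesis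
        using line_unique[of p q a b a' b'] line_unique[of q p a b a' b'] in_line ab by auto
    qed
    have GG: "A = A'" if "A \<in> \<G>" "A' \<in> \<G>" "p \<in> A \<inter> A'" "q \<in> A \<inter> A'" "p \<noteq> q" for A A' p q
    proof -
      obtain c c' where c: "A = group c" "A' = group c'"
        using \<open>A \<in> \<G>\<close> \<open>A' \<in> \<G>\<close> by (auto simp: \<G>_def)
      have "p \<notin> E \<or> q \<notin> E" using E_eq \<open>p \<noteq> q\<close> by blast
      then have "c = c'" using that(3,4) unfolding c Int_iff mem_group by auto
      then show ?thesis using c by simp
    qed
    have LG: False if "A \<in> \<L>" "A' \<in> \<G>" "p \<in> A \<inter> A'" "q \<in> A \<inter> A'" "p \<noteq> q" for A A' p q
    proof -
      obtain a b c where "A = line a b" "A' = group c" using \<open>A \<in> \<L>\<close> \<open>A' \<in> \<G>\<close> by (auto simp: \<L>_def \<G>_def)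
      then have "p \<in> line a b" "q \<in> line a b" "p \<in> group c" "q \<in> group c" using that(3,4) by auto
      then have "fst p = fst q" using line_E[of p a b] line_E[of q a b] unfolding mem_group by simp
      then show False using line_fst \<open>p \<in> line a b\<close> \<open>q \<in> line a b\<close> \<open>p \<noteq> q\<close> by blast
    qed
    fix A A' p q
    assume "A \<in> \<L> \<union> \<G>" "A' \<in> \<L> \<union> \<G>" and pq: "p \<in> A \<inter> A'" "q \<in> A \<inter> A'" "p \<noteq> q"
    then consider "A \<in> \<L>" "A' \<in> \<L>" | "A \<in> \<G>" "A' \<in> \<G>" | "A \<in> \<L>" "A' \<in> \<G>" | "A \<in> \<G>" "A' \<in> \<L>"
      by blast
    then show "A = A'"
    proof cases
      case 1 then show ?thesis using LL pq by blast
    next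
      case 2 then show ?thesis using GG pq by blast
    next
      case 3 then show ?thesis using LG pq by blast
    next
      case 4 then show ?thesis using LG[of A' A p q] pq by blast
    qed
  qed
  have "card A \<in> gdd3_orders" if "A \<in> \<L> \<union> \<G>" for A
  proof -
    have "card (line a b) \<in> gdd3_orders" for a b
    proof -
      have "card ((\<lambda>c. (c, (a + c * b) mod int t)) ` {0..3}) = 4"
        by (subst card_image) (auto simp: inj_on_def)
      then have "card (line a b) = 4 + card (H \<inter> {b})"
        unfolding line_def by (subst card_Un_disjoint) (auto simp: card_cartesian_product)
      then show ?thesis using orders by (cases "b \<in> H") simp_all
    qed
    moreover have "card (group c) \<in> gdd3_orders" if "c \<in> {0..4}" for c
    proof -
      have "card (group c) = card ({c} \<times> (if c = 4 then H else T)) + card E"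
        unfolding group_def using fin that disj(2) by (intro card_Un_disjoint) simp_all
      then show ?thesis using card orders by (simp add: card_cartesian_product split: if_splits)
    qed
    ultimately show ?thesis using that unfolding \<L>_def \<G>_def by auto
  qed
  then show ?thesis using card_in_gdd3_orders[OF X(1) pbd] X(2) by auto
qed

section \<open>Steiner systems of block size four\<close>

lemma less_two_in_gdd3_orders: "r < 2 \<Longrightarrow> r \<in> gdd3_orders"
  by (auto simp: gdd3_orders_def gdd3_def less_Suc_eq numeral_2_eq_2 intro!: exI[of _ "{}"])

lemma coprime_6_if_mod:
  fixes t :: nat
  assumes "t mod 6 = 1 \<or> t mod 6 = 5"
  shows "coprime t 6"
proof -
  have "gcd t 6 = gcd 6 (t mod 6)" by (simp add: gcd_non_0_nat)
  also have "\<dots> = 1" using assms by (elim disjE) (simp_all add: gcd_non_0_nat)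
  finally show ?thesis by (simp add: coprime_iff_gcd_eq_1)
qed

text \<open>
  For \<open>t\<close> odd, \<open>e\<close> is chosen to make \<open>t + e\<close> congruent to 0 or 1 modulo 4. Then the remaining column has
  \<open>h + e = r - 4t\<close> points, which has the residue of \<open>r\<close>, so both sizes are covered by the induction
  hypothesis as soon as \<open>4t + e \<le> r \<le> 5t + e\<close>.
\<close>

lemma in_gdd3_orders_if_mod_4:
  fixes r :: nat
  assumes "r mod 4 = 0 \<or> r mod 4 = 1"
  shows "r \<in> gdd3_orders"
  using assms
proof (induction r rule: less_induct)
  case (less r)
  have base: "5 \<in> gdd3_orders" "8 \<in> gdd3_orders" "9 \<in> gdd3_orders" "12 \<in> gdd3_orders"
    "17 \<in> gdd3_orders" "41 \<in> gdd3_orders" "44 \<in> gdd3_orders"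
    using starter_5 starter_8 starter_9 starter_12 starter_17 starter_41 starter_44
    by (auto dest!: starter_in_gdd3_orders)
  have tripled: "3 * s + 1 \<in> gdd3_orders" if "s \<in> gdd3_orders" for s
    using triple_plus_one_in_gdd3_orders[OF four_in_gdd3_orders that] .
  have truncated: ?case
    if t: "t mod 6 = 1 \<or> t mod 6 = 5" and e: "e = (if t mod 4 = 1 then 0 else 1)"
      and le: "4 * t + e \<le> r" "r \<le> 5 * t + e" for t e
  proof -
    have "t mod 4 = 1 \<or> t mod 4 = 3" using t by presburger
    then have "(t + e) mod 4 = 0 \<or> (t + e) mod 4 = 1" using e by presburger
    moreover have "t + e < r" using le t by (cases "t = 0") auto
    ultimately have te: "t + e \<in> gdd3_orders" by (intro less.IH)
    have "r = (r - 4 * t) + 4 * t" using le(1) by simp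
    then have "(r - 4 * t) mod 4 = r mod 4" by (metis mod_mult_self2)
    moreover have "r - 4 * t < r" using t le(1) by (cases "t = 0") auto
    ultimately have "r - 4 * t \<in> gdd3_orders" using less.prems by (intro less.IH) auto
    moreover have "r - 4 * t = (r - 4 * t - e) + e" using le(1) by simp
    ultimately have he: "(r - 4 * t - e) + e \<in> gdd3_orders" by simp
    have "4 * t + (r - 4 * t - e) + e \<in> gdd3_orders"
    proof (rule truncated_transversal_in_gdd3_orders)
      show "coprime t 6" using t by (rule coprime_6_if_mod)
      show "0 < t" using t by (cases "t = 0") auto
    qed (use e le te he base four_in_gdd3_orders in auto)
    then show ?case using le(1) by simp
  qed
  show ?case
  proof (cases "77 \<le> r")
    case True
    define u where "u = (r - 1) div 4"
    have u: "4 * u + 1 \<le> r" "r \<le> 4 * u + 4" "19 \<le> u" using True by (auto simp: u_def)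
    \<comment> \<open>From \<open>t \<ge> u - 3\<close> it follows that \<open>r - 4t \<le> 16\<close>, and \<open>16 \<le> t\<close> because \<open>u \<ge> 19\<close>.\<close>
    have "\<exists>t. (t mod 6 = 1 \<or> t mod 6 = 5) \<and> t \<le> u \<and> u \<le> t + 3"
      using u(3) by presburger
    then obtain t where t: "t mod 6 = 1 \<or> t mod 6 = 5" "t \<le> u" "u \<le> t + 3" by blast
    show ?thesis by (rule truncated[OF t(1) refl]) (use u t in auto)
  next
    case False
    \<comment> \<open>The intervals belong to \<open>t = 5, 7, 11, 13, 17\<close>; the orders 13, 16, 28, 37, 40 have the form
      \<open>3s + 1\<close>, and the others in the list are explicit.\<close>
    have "r < 2 \<or> r \<in> {4, 5, 8, 9, 12, 13, 16, 17, 28, 37, 40, 41, 44} \<or>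
        20 \<le> r \<and> r \<le> 25 \<or> 29 \<le> r \<and> r \<le> 36 \<or> 45 \<le> r \<and> r \<le> 56 \<or>
        57 \<le> r \<and> r \<le> 65 \<or> 68 \<le> r \<and> r \<le> 76"
      using False less.prems by simp presburger
    moreover have "13 \<in> gdd3_orders" using tripled[OF four_in_gdd3_orders] by simp
    moreover have "16 \<in> gdd3_orders" "28 \<in> gdd3_orders" "37 \<in> gdd3_orders"
      using tripled[of 5] tripled[of 9] tripled[of 12] base by simp_all
    moreover have "40 \<in> gdd3_orders" using tripled[OF \<open>13 \<in> gdd3_orders\<close>] by simp
    ultimately consider "r \<in> gdd3_orders"
      | "20 \<le> r" "r \<le> 25" | "29 \<le> r" "r \<le> 36" | "45 \<le> r" "r \<le> 56"
      | "57 \<le> r" "r \<le> 65" | "68 \<le> r" "r \<le> 76"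
      using less_two_in_gdd3_orders[of r] base four_in_gdd3_orders by auto
    then show ?thesis
    proof cases
      case 2 then show ?thesis using truncated[of 5 0] by simp
    next
      case 3 then show ?thesis using truncated[of 7 1] by simp
    next
      case 4 then show ?thesis using truncated[of 11 1] by simp
    next
      case 5 then show ?thesis using truncated[of 13 0] by simp
    next
      case 6 then show ?thesis using truncated[of 17 0] by simp
    qed simp
  qed
qed

corollary steiner_system_exists:
  fixes r :: nat
  assumes "r mod 4 = 0 \<or> r mod 4 = 1"
  shows "\<exists>(X :: (nat \<times> int) set) \<A>. finite X \<and> card X = 3 * r + 1 \<and> pbd X \<A> \<and> (\<forall>A\<in>\<A>. card A = 4)"
  using steiner_system_if_gdd3[OF in_gdd3_orders_if_mod_4[OF assms]] .

section \<open>Linear quadruple systems\<close>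

lemma pbd_4_card:
  assumes fin: "finite X" and pbd: "pbd X \<A>" and four: "\<And>A. A \<in> \<A> \<Longrightarrow> card A = 4"
  shows "12 * card \<A> = card X * (card X - 1)"
proof -
  define pairs where "pairs A = (SIGMA x : A. A - {x})" for A :: "'a set"
  note sub = pbd_subset[OF pbd]
  have finA: "finite \<A>" using sub fin by (meson Pow_iff finite_Pow_iff finite_subset subsetI)
  have fin4: "finite A" if "A \<in> \<A>" for A using sub[OF that] fin by (rule finite_subset)
  have pairs_card: "card (pairs A) = card A * (card A - 1)" if "finite A" for A
    using that by (simp add: pairs_def)
  have "pairs X = (\<Union>A\<in>\<A>. pairs A)"
  proof
    show "pairs X \<subseteq> (\<Union>A\<in>\<A>. pairs A)"
    proof
      fix z assume "z \<in> pairs X"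
      then obtain x y where z: "z = (x, y)" "x \<in> X" "y \<in> X" "x \<noteq> y" by (auto simp: pairs_def)
      then obtain A where "A \<in> \<A>" "x \<in> A" "y \<in> A" using pbd_cover[OF pbd] by blast
      then show "z \<in> (\<Union>A\<in>\<A>. pairs A)" using z by (auto simp: pairs_def)
    qed
    show "(\<Union>A\<in>\<A>. pairs A) \<subseteq> pairs X"
      using sub unfolding pairs_def by blast
  qed
  moreover have "card (\<Union>A\<in>\<A>. pairs A) = (\<Sum>A\<in>\<A>. card (pairs A))"
  proof (rule card_UN_disjoint[OF finA])
    show "\<forall>A\<in>\<A>. finite (pairs A)" using fin4 by (simp add: pairs_def)
    show "\<forall>A\<in>\<A>. \<forall>B\<in>\<A>. A \<noteq> B \<longrightarrow> pairs A \<inter> pairs B = {}"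
    proof (intro ballI impI)
      fix A B assume AB: "A \<in> \<A>" "B \<in> \<A>" "A \<noteq> B"
      have "\<not> (x \<in> A \<and> y \<in> A \<and> x \<in> B \<and> y \<in> B \<and> x \<noteq> y)" for x y
        using pbd_unique[OF pbd AB(1,2), of x y] AB(3) by blast
      then show "pairs A \<inter> pairs B = {}" by (auto simp: pairs_def)
    qed
  qed
  moreover have "(\<Sum>A\<in>\<A>. card (pairs A)) = 12 * card \<A>"
    using four fin4 pairs_card by simp
  ultimately show ?thesis using pairs_card[OF fin] by simp
qed

lemma linear_4_tree_card_verts:
  assumes "linear_4_tree k T"
  shows "finite (verts T)" "card (verts T) = 3 * k + 1"
proof -
  have "finite (verts T) \<and> card (verts T) = 3 * k + 1"
    using assms
  proof (induction rule: linear_4_tree.induct)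
    case (single e)
    then show ?case by (simp add: card_ge_0_finite)
  next
    case (add k V E e)
    have "finite e" using add.hyps(2) by (simp add: card_ge_0_finite)
    then have "card (V \<union> e) + card (e \<inter> V) = card V + card e"
      using add.IH card_Un_Int[of V e] by (simp add: Int_commute)
    then show ?case using add \<open>finite e\<close> by simp
  qed
  then show "finite (verts T)" "card (verts T) = 3 * k + 1" by simp_all
qed

text \<open>Connectedness: each new quadruple shares a vertex with the earlier ones.\<close>

lemma linear_4_tree_constant:
  assumes "linear_4_tree k T"
    and "\<And>e x y. e \<in> edges T \<Longrightarrow> x \<in> e \<Longrightarrow> y \<in> e \<Longrightarrow> \<kappa> x = \<kappa> y"
    and "x \<in> verts T" "y \<in> verts T"
  shows "\<kappa> x = \<kappa> y"
proof -
  have "\<exists>c. \<forall>x\<in>verts T. \<kappa> x = c"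
    using assms(1,2)
  proof (induction rule: linear_4_tree.induct)
    case (single e)
    then show ?case by (metis fst_conv snd_conv singletonI)
  next
    case (add k V E e)
    obtain c where c: "\<forall>x\<in>V. \<kappa> x = c" using add.IH add.prems by auto
    obtain z where "z \<in> e" "z \<in> V" using add.hyps(3) by (metis IntE card_1_singletonE insertI1)
    then have "\<forall>x\<in>e. \<kappa> x = c" using add.prems[of e] c by (metis insertI1 snd_conv)
    then show ?case using c by auto
  qed
  then show ?thesis using assms(3,4) by auto
qed

text \<open>
  The function \<open>\<kappa>\<close> labels the parts of the vertex set. A copy of the tree stays within one part, but a
  part with at most \<open>3k\<close> vertices has no room for \<open>3k + 1\<close>.
\<close>

lemma free_of_linear_4_tree_if_small_components:
  fixes H :: "'a hypergraph" and T :: "'b hypergraph"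
  assumes T: "linear_4_tree k T"
    and edge: "\<And>e x y. e \<in> edges H \<Longrightarrow> x \<in> e \<Longrightarrow> y \<in> e \<Longrightarrow> \<kappa> x = \<kappa> y"
    and small: "\<And>j. finite {x \<in> verts H. \<kappa> x = j}" "\<And>j. card {x \<in> verts H. \<kappa> x = j} \<le> 3 * k"
  shows "free_of T H"
  unfolding free_of_def
proof
  assume "\<exists>H'. subhypergraph H' H \<and> isomorphic T H'"
  then obtain H' where "subhypergraph H' H" "isomorphic T H'" by blast
  then have H': "verts H' \<subseteq> verts H" "edges H' \<subseteq> edges H"
    and "\<exists>f. bij_betw f (verts T) (verts H') \<and> edges H' = (\<lambda>e. f ` e) ` edges T"
    by (simp_all add: subhypergraph_def isomorphic_def)
  then obtain f where f: "bij_betw f (verts T) (verts H')" "edges H' = (\<lambda>e. f ` e) ` edges T"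
    by blast
  have "(\<kappa> \<circ> f) x = (\<kappa> \<circ> f) y" if "e \<in> edges T" "x \<in> e" "y \<in> e" for e x y
    unfolding comp_apply using H'(2) f(2) that by (intro edge[of "f ` e"]) auto
  then have const: "\<kappa> (f x) = \<kappa> (f y)" if "x \<in> verts T" "y \<in> verts T" for x y
    using linear_4_tree_constant[OF T _ that, of "\<kappa> \<circ> f"] unfolding comp_apply by blast
  have "verts T \<noteq> {}" using linear_4_tree_card_verts[OF T] by auto
  then obtain x0 where "x0 \<in> verts T" by blast
  then have "f ` verts T \<subseteq> {x \<in> verts H. \<kappa> x = \<kappa> (f x0)}"
    using const[OF _ \<open>x0 \<in> verts T\<close>] bij_betwE[OF f(1)] H'(1) by blast
  then have "card (f ` verts T) \<le> 3 * k" using small by (meson card_mono order_trans)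
  moreover have "card (f ` verts T) = 3 * k + 1"
    using linear_4_tree_card_verts(2)[OF T] card_image[OF bij_betw_imp_inj_on[OF f(1)]] by simp
  ultimately show False by simp
qed

text \<open>
  The copies live on \<open>{..<q} \<times> X\<close> and are carried to the natural numbers by an injection \<open>\<phi>\<close>; the label
  \<open>\<kappa>\<close> recovers the number of the copy.
\<close>

lemma disjoint_copies_exist:
  fixes X :: "'a set"
  assumes fin: "finite X" and pbd: "pbd X \<A>" and four: "\<And>A. A \<in> \<A> \<Longrightarrow> card A = 4"
  obtains H :: "nat hypergraph" and \<kappa> :: "nat \<Rightarrow> nat"
  where "quadruple_system H" "linear_system H"
    "card (verts H) = q * card X" "card (edges H) = q * card \<A>"
    "\<And>e x y. e \<in> edges H \<Longrightarrow> x \<in> e \<Longrightarrow> y \<in> e \<Longrightarrow> \<kappa> x = \<kappa> y"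
    "\<And>j. card {x \<in> verts H. \<kappa> x = j} \<le> card X"
proof -
  define P where "P = {..<q} \<times> X"
  have finP: "finite P" using fin by (simp add: P_def)
  obtain \<phi> :: "nat \<times> 'a \<Rightarrow> nat" where "bij_betw \<phi> P {0..<card P}"
    using ex_bij_betw_finite_nat[OF finP] by blast
  then have inj: "inj_on \<phi> P" by (rule bij_betw_imp_inj_on)
  define copy where "copy = (\<lambda>(j, A). \<phi> ` ({j} \<times> A))"
  define \<kappa> where "\<kappa> v = fst (inv_into P \<phi> v)" for v
  define V where "V = \<phi> ` P"
  define E where "E = copy ` ({..<q} \<times> \<A>)"
  note sub = pbd_subset[OF pbd]
  have \<kappa>: "\<kappa> (\<phi> (j, a)) = j" if "j < q" "a \<in> X" for j a
    using that inj by (simp add: \<kappa>_def P_def)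
  have copies_eq: "j = j' \<and> A = A'"
    if jA: "j < q" "j' < q" "A \<in> \<A>" "A' \<in> \<A>"
      and xy: "x \<in> copy (j, A)" "y \<in> copy (j, A)" "x \<in> copy (j', A')" "y \<in> copy (j', A')" "x \<noteq> y"
    for j j' A A' x y
  proof -
    obtain a b where ab: "a \<in> A" "b \<in> A" "x = \<phi> (j, a)" "y = \<phi> (j, b)"
      using xy(1,2) by (auto simp: copy_def)
    obtain a' b' where ab': "a' \<in> A'" "b' \<in> A'" "x = \<phi> (j', a')" "y = \<phi> (j', b')"
      using xy(3,4) by (auto simp: copy_def)
    have P: "(j, a) \<in> P" "(j, b) \<in> P" "(j', a') \<in> P" "(j', b') \<in> P"
      using jA ab(1,2) ab'(1,2) sub by (auto simp: P_def)
    have "(j, a) = (j', a')" "(j, b) = (j', b')"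
      using inj_onD[OF inj, of "(j, a)" "(j', a')"] inj_onD[OF inj, of "(j, b)" "(j', b')"] P ab ab'
      by simp_all
    moreover have "a \<noteq> b" using \<open>x \<noteq> y\<close> ab by auto
    ultimately show ?thesis using pbd_unique[OF pbd jA(3,4), of a b] ab ab' by simp
  qed
  have card_copy: "card (copy (j, A)) = 4" if "j < q" "A \<in> \<A>" for j A
  proof -
    have "inj_on \<phi> ({j} \<times> A)" using that sub by (intro inj_on_subset[OF inj]) (auto simp: P_def)
    then show ?thesis using four[OF that(2)] by (simp add: copy_def card_image card_cartesian_product)
  qed
  have "inj_on copy ({..<q} \<times> \<A>)"
  proof (rule inj_onI)
    fix u w assume uw: "u \<in> {..<q} \<times> \<A>" "w \<in> {..<q} \<times> \<A>" and eq: "copy u = copy w"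
    obtain j A j' A' where u: "u = (j, A)" and w: "w = (j', A')" by (cases u, cases w)
    have "card (copy u) = 4" using card_copy uw u by simp
    then have "\<not> card (copy u) \<le> Suc 0" by simp
    then obtain x y where "x \<in> copy u" "y \<in> copy u" "x \<noteq> y"
      using card_le_Suc0_iff_eq[of "copy u"] \<open>card (copy u) = 4\<close> by (metis card.infinite zero_neq_numeral)
    then show "u = w" using copies_eq[of j j' A A' x y] eq uw u w by simp
  qed
  then have card_E: "card E = q * card \<A>"
    by (simp add: E_def card_image card_cartesian_product)
  show thesis
  proof (rule that[of "(V, E)" \<kappa>])
    show "quadruple_system (V, E)"
      unfolding quadruple_system_def
    proof (intro conjI ballI)
      show "finite (verts (V, E))" using finP by (simp add: V_def)
      fix e assume "e \<in> edges (V, E)"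
      then obtain j A where e: "j < q" "A \<in> \<A>" "e = copy (j, A)" by (auto simp: E_def)
      then show "e \<subseteq> verts (V, E)" "card e = 4"
        using sub card_copy by (auto simp: V_def copy_def P_def)
    qed
    show "linear_system (V, E)"
      unfolding linear_system_def
    proof (intro ballI impI)
      fix x y e f
      assume "x \<noteq> y" "e \<in> edges (V, E)" "f \<in> edges (V, E)" and xy: "{x, y} \<subseteq> e" "{x, y} \<subseteq> f"
      then obtain j A j' A' where "j < q" "A \<in> \<A>" "e = copy (j, A)" "j' < q" "A' \<in> \<A>" "f = copy (j', A')"
        by (auto simp: E_def)
      then show "e = f" using copies_eq[of j j' A A' x y] xy \<open>x \<noteq> y\<close> by simp
    qed
    show "card (verts (V, E)) = q * card X"
      using card_image[OF inj] by (simp add: V_def P_def card_cartesian_product)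
    show "card (edges (V, E)) = q * card \<A>" using card_E by simp
  next
    fix e x y assume "e \<in> edges (V, E)" "x \<in> e" "y \<in> e"
    then obtain j A a b where "j < q" "A \<in> \<A>" "a \<in> A" "b \<in> A" "x = \<phi> (j, a)" "y = \<phi> (j, b)"
      by (auto simp: E_def copy_def)
    moreover from this have "a \<in> X" "b \<in> X" using sub[of A] by auto
    ultimately show "\<kappa> x = \<kappa> y" using \<kappa>[of j a] \<kappa>[of j b] by simp
  next
    fix j
    have "{x \<in> verts (V, E). \<kappa> x = j} \<subseteq> \<phi> ` ({j} \<times> X)"
      using \<kappa> by (auto simp: V_def P_def)
    then have "card {x \<in> verts (V, E). \<kappa> x = j} \<le> card (\<phi> ` ({j} \<times> X))"
      using fin by (intro card_mono) auto
    also have "\<dots> \<le> card ({j} \<times> X)" using fin by (intro card_image_le) simp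
    finally show "card {x \<in> verts (V, E). \<kappa> x = j} \<le> card X" by (simp add: card_cartesian_product)
  qed
qed

text \<open>
  Given \<open>k\<close> quadruples through \<open>v\<close>, match them with the quadruples of the star and send the centre to
  \<open>v\<close> and the other three vertices of each quadruple bijectively to the other three vertices of its
  partner. These partial maps agree on the star because its quadruples share only the centre, and
  they are jointly injective because by linearity the host quadruples share only \<open>v\<close>.
\<close>

lemma degree_less_if_star_free:
  fixes H :: "'a hypergraph" and S :: "'b hypergraph"
  assumes H: "quadruple_system H" "linear_system H" and S: "linear_4_star k S" and free: "free_of S H"
    and v: "v \<in> verts H"
  shows "card {e \<in> edges H. v \<in> e} < k"
proof (rule ccontr)
  assume "\<not> card {e \<in> edges H. v \<in> e} < k"
  then have "k \<le> card {e \<in> edges H. v \<in> e}" by simp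
  then obtain A where A: "A \<subseteq> {e \<in> edges H. v \<in> e}" "card A = k" "finite A"
    by (rule obtain_subset_with_card_n)
  have tree: "linear_4_tree k S" using S by (simp add: linear_4_star_def)
  obtain c where "\<forall>e\<in>edges S. c \<in> e"
    and "\<forall>e\<in>edges S. \<forall>f\<in>edges S. e \<noteq> f \<longrightarrow> (e - {c}) \<inter> (f - {c}) = {}"
    using S[unfolded linear_4_star_def, THEN conjunct2] by (elim exE conjE) (rule that)
  note c = this(1)[rule_format] and disj = this(2)[rule_format]
  note wf = linear_4_tree_wf[OF tree]
  have "finite (edges S)"
    using linear_4_tree_card_verts(1)[OF tree] unfolding wf(2) by (rule finite_UnionD)
  then obtain g where g: "bij_betw g (edges S) A"
    using finite_same_card_bij[of "edges S" A] A(2,3) wf(3) by auto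
  have gE: "g e \<in> edges H" "v \<in> g e" if "e \<in> edges S" for e
    using bij_betwE[OF g] that A(1) by auto
  have "\<exists>\<phi>. bij_betw \<phi> (e - {c}) (g e - {v})" if "e \<in> edges S" for e
  proof -
    have "card e = 4" "card (g e) = 4"
      using wf(1) H(1) that gE(1)[OF that] by (auto simp: quadruple_system_def)
    then have "card (e - {c}) = card (g e - {v})" "finite (e - {c})" "finite (g e - {v})"
      using c[OF that] gE(2)[OF that] by (simp_all add: card_ge_0_finite)
    then show ?thesis by (intro finite_same_card_bij)
  qed
  then obtain \<phi> where \<phi>: "bij_betw (\<phi> e) (e - {c}) (g e - {v})" if "e \<in> edges S" for e by metis
  define f where "f x = (if x = c then v else \<phi> (SOME e. e \<in> edges S \<and> x \<in> e) x)" for x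
  have f_eq: "f x = \<phi> e x" if "e \<in> edges S" "x \<in> e - {c}" for e x
  proof -
    have "(SOME e. e \<in> edges S \<and> x \<in> e) = e"
    proof (rule some_equality)
      fix e' assume "e' \<in> edges S \<and> x \<in> e'"
      then show "e' = e" using disj[of e' e] that by blast
    qed (use that in simp)
    then show ?thesis using that by (simp add: f_def)
  qed
  have f_c: "f c = v" by (simp add: f_def)
  have f_other: "f ` (e - {c}) = g e - {v}" if "e \<in> edges S" for e
    using bij_betw_imp_surj_on[OF \<phi>[OF that]] f_eq[OF that] by (metis image_cong)
  have f_edge: "f ` e = g e" if "e \<in> edges S" for e
  proof -
    have "f ` e = insert (f c) (f ` (e - {c}))" using c[OF that] by blast
    then show ?thesis using f_other[OF that] f_c gE(2)[OF that] by (simp add: insert_absorb)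
  qed
  have not_v: "f x \<in> g e - {v}" if "e \<in> edges S" "x \<in> e - {c}" for e x
    using f_other[OF that(1)] that(2) by blast
  have f_v: "f x = v \<longleftrightarrow> x = c" if "e \<in> edges S" "x \<in> e" for e x
    using not_v[OF that(1), of x] f_c that(2) by blast
  have "inj_on f (verts S)"
  proof (rule inj_onI)
    fix x y assume xy: "x \<in> verts S" "y \<in> verts S" and eq: "f x = f y"
    obtain d e where d: "d \<in> edges S" "x \<in> d" and e: "e \<in> edges S" "y \<in> e"
      using xy wf(2) by auto
    show "x = y"
    proof (cases "x = c \<or> y = c")
      case True
      then show ?thesis using f_v[OF d] f_v[OF e] eq by auto
    next
      case False
      have fx: "f x \<in> g d - {v}" "f x \<in> g e - {v}"
        using not_v[OF d(1), of x] not_v[OF e(1), of y] d e eq False by auto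
      have "g d \<subseteq> verts H" using gE(1)[OF d(1)] H(1) by (auto simp: quadruple_system_def)
      then have "f x \<in> verts H" using fx by blast
      then have "g d = g e"
        using H(2)[unfolded linear_system_def, rule_format, of "f x" v "g d" "g e"]
          fx v gE[OF d(1)] gE[OF e(1)] by blast
      then have "d = e" using inj_onD[OF bij_betw_imp_inj_on[OF g]] d e by blast
      then have "\<phi> e x = \<phi> e y" using f_eq[OF e(1)] eq d e False by simp
      then show ?thesis
        using inj_onD[OF bij_betw_imp_inj_on[OF \<phi>[OF e(1)]]] \<open>d = e\<close> d e False by blast
    qed
  qed
  then have "bij_betw f (verts S) (f ` verts S)" by (simp add: bij_betw_def)
  moreover have "f ` verts S = \<Union> A"
  proof -
    have "f ` verts S = (\<Union>e\<in>edges S. f ` e)" unfolding wf(2) by blast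
    also have "\<dots> = (\<Union>e\<in>edges S. g e)" using f_edge by simp
    finally show ?thesis using bij_betw_imp_surj_on[OF g] by simp
  qed
  moreover have "A = (\<lambda>e. f ` e) ` edges S"
    using bij_betw_imp_surj_on[OF g] f_edge by (metis image_cong)
  ultimately have "isomorphic S (\<Union> A, A)" unfolding isomorphic_def by auto
  moreover have "subhypergraph (\<Union> A, A) H"
    using A(1) H(1) by (auto simp: subhypergraph_def quadruple_system_def)
  ultimately show False using free by (auto simp: free_of_def)
qed

lemma star_free_card_edges:
  fixes H :: "'a hypergraph" and S :: "'b hypergraph"
  assumes H: "quadruple_system H" "linear_system H" and S: "linear_4_star k S" and free: "free_of S H"
  shows "4 * card (edges H) \<le> card (verts H) * (k - 1)"
proof -
  have edge: "e \<subseteq> verts H" "card e = 4" if "e \<in> edges H" for e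
    using H(1) that by (auto simp: quadruple_system_def)
  have finV: "finite (verts H)" using H(1) by (simp add: quadruple_system_def)
  have finE: "finite (edges H)"
    using edge(1) finV by (meson Pow_iff finite_Pow_iff finite_subset subsetI)
  have "card {v \<in> verts H. v \<in> e} = 4" if "e \<in> edges H" for e
  proof -
    have "{v \<in> verts H. v \<in> e} = e" using edge(1)[OF that] by blast
    then show ?thesis using edge(2)[OF that] by simp
  qed
  then have "4 * card (edges H) = (\<Sum>v\<in>verts H. card {e \<in> edges H. v \<in> e})"
    using sum_multicount_gen[OF finV finE, of "\<lambda>v e. v \<in> e" "\<lambda>_. 4"] by simp
  also have "\<dots> \<le> (\<Sum>v\<in>verts H. k - 1)"
  proof (rule sum_mono)
    fix v assume "v \<in> verts H"
    from degree_less_if_star_free[OF H S free this]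
    show "card {e \<in> edges H. v \<in> e} \<le> k - 1" by simp
  qed
  finally show ?thesis by simp
qed

lemma ex_lin4_tree_ge:
  fixes T :: "'a hypergraph"
  assumes T: "linear_4_tree (Suc r) T" and r: "r mod 4 = 0 \<or> r mod 4 = 1"
  shows "q * (3 * r + 1) * r \<le> 4 * ex_lin4 (q * (3 * r + 1)) T"
proof -
  obtain X :: "(nat \<times> int) set" and \<A> where X: "finite X" "card X = 3 * r + 1" "pbd X \<A>"
    and four: "\<And>A. A \<in> \<A> \<Longrightarrow> card A = 4"
    using steiner_system_exists[OF r] by blast
  obtain H :: "nat hypergraph" and \<kappa> :: "nat \<Rightarrow> nat" where H: "quadruple_system H" "linear_system H"
      "card (verts H) = q * card X" "card (edges H) = q * card \<A>"
    and edge: "\<And>e x y. e \<in> edges H \<Longrightarrow> x \<in> e \<Longrightarrow> y \<in> e \<Longrightarrow> \<kappa> x = \<kappa> y"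
    and small: "\<And>j. card {x \<in> verts H. \<kappa> x = j} \<le> card X"
    using disjoint_copies_exist[OF X(1,3) four, where q = q] by blast
  have "free_of T H"
  proof (rule free_of_linear_4_tree_if_small_components[OF T edge])
    show "finite {x \<in> verts H. \<kappa> x = j}" for j using H(1) by (simp add: quadruple_system_def)
    show "card {x \<in> verts H. \<kappa> x = j} \<le> 3 * Suc r" for j using small[of j] X(2) by simp
  qed
  then have "card (edges H) \<in> ex_lin4_sizes (q * (3 * r + 1)) T"
    unfolding ex_lin4_sizes_def using H X(2) by (intro CollectI exI[of _ H]) simp
  then have "q * card \<A> \<le> ex_lin4 (q * (3 * r + 1)) T"
    unfolding ex_lin4_def using H(4) finite_ex_lin4_sizes by (metis Max_ge)
  moreover have "4 * (q * card \<A>) = q * (3 * r + 1) * r"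
  proof -
    have "4 * card \<A> = (3 * r + 1) * r"
      using pbd_4_card[OF X(1,3) four] X(2) by simp
    then have "q * (4 * card \<A>) = q * ((3 * r + 1) * r)" by (rule arg_cong)
    then show ?thesis by (simp only: ac_simps)
  qed
  ultimately show ?thesis by linarith
qed

lemma ex_lin4_star_le:
  fixes S :: "'a hypergraph"
  assumes S: "linear_4_star k S"
  shows "4 * ex_lin4 n S \<le> n * (k - 1)"
proof -
  have "edges S \<noteq> {}" using S linear_4_tree_wf(4)[of k S] unfolding linear_4_star_def by blast
  then have "ex_lin4 n S \<in> ex_lin4_sizes n S"
    unfolding ex_lin4_def by (intro Max_in finite_ex_lin4_sizes ex_lin4_sizes_nonempty)
  then obtain H :: "nat hypergraph" where "ex_lin4 n S = card (edges H)" "quadruple_system H"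
      "linear_system H" "card (verts H) = n" "free_of S H"
    unfolding ex_lin4_sizes_def by blast
  then show ?thesis using star_free_card_edges[of H k S] S by simp
qed

theorem proposition1p2:
  fixes n k :: nat
  assumes "n \<ge> 1" and "k \<ge> 1"
    and "(3 * k - 2) dvd n"
    and "[3 * k - 2 = 1] (mod 12) \<or> [3 * k - 2 = 4] (mod 12)"
  shows "(\<forall>T :: 'a hypergraph. linear_4_tree k T \<longrightarrow>
            real (ex_lin4 n T) \<ge> real n * (real k - 1) / 4) \<and>
         (\<forall>S :: 'a hypergraph. linear_4_star k S \<longrightarrow>
            real (ex_lin4 n S) = real n * (real k - 1) / 4)"
proof -
  obtain r where k: "k = Suc r" using assms(2) by (cases k) auto
  obtain q where n: "n = q * (3 * r + 1)" using assms(3) k by (auto simp: mult.commute elim: dvdE)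
  have r: "r mod 4 = 0 \<or> r mod 4 = 1"
    using assms(4) unfolding k cong_def by simp presburger
  have lower: "real n * (real k - 1) / 4 \<le> real (ex_lin4 n T)" if "linear_4_tree k T" for T :: "'a hypergraph"
  proof -
    have "n * r \<le> 4 * ex_lin4 n T" using ex_lin4_tree_ge[OF that[unfolded k] r] n by simp
    then have "real (n * r) \<le> real (4 * ex_lin4 n T)" by (rule of_nat_mono)
    then show ?thesis by (simp add: k)
  qed
  moreover have "real (ex_lin4 n S) = real n * (real k - 1) / 4" if S: "linear_4_star k S" for S :: "'a hypergraph"
  proof -
    have "4 * ex_lin4 n S \<le> n * r" using ex_lin4_star_le[OF S] k by simp
    then have "real (4 * ex_lin4 n S) \<le> real (n * r)" by (rule of_nat_mono)
    then have "real (ex_lin4 n S) \<le> real n * (real k - 1) / 4" by (simp add: k)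
    moreover have "linear_4_tree k S" using S by (simp add: linear_4_star_def)
    ultimately show ?thesis using lower by (intro antisym) blast+
  qed
  ultimately show ?thesis by blast
qed

end
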